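(* Let $G$ be a ribbon graph or an embedded graph. Then $$\Omega(G;-2,1,0,1,\lambda)=\sum_{A\subseteq E(G)}\chi\big((G^{\tau(A)})^*;\lambda\big),$$ where $\chi(H;\lambda)$ is the chromatic polynomial of $H$.
   Context: **Ribbon graphs.** A ribbon graph $G=(V(G),E(G))$ is a surface with boundary, represented as the union of two sets of discs, a set $V(G)$ of vertices and a set $E(G)$ of edges, such that: (1) the vertices and edges intersect in disjoint line segments; (2) each such line segment lies on the boundary of precisely one vertex and precisely one edge; (3) every edge contains exactly two such line segments. Equivalence is homeomorphism (orientation preserving when orientable) mapping vertices to vertices and edges to edges. An embedded graph is described by the ribbon graph given by its regular neighbourhood in the surface, and the two sides of the identity are those of this ribbon graph. Let $e\in E(G)$. *Deletion:* $G\setminus e$ is obtained by removing the edge $e$. *Contraction:* if $u,v$ are the (not necessarily distinct) vertices incident with $e$, consider the boundary component(s) of $e\cup\{u,v\}$ as curves on $G$; for each curve attach a disc (a new vertex) by identifying its boundary with the curve, and then delete $e,u,v$; the result is $G/e$. *Partial Petrial:* $G^{\tau(e)}$ is obtained by detaching one end of $e$ from its incident vertex $v$, creating arcs $[a,b]$ on $v$ and $[a',b']$ on $e$ (so that $G$ is recovered by identifying $[a,b]$ with $[a',b']$), and reattaching by identifying $[a,b]$ with $[b',a']$ (giving $e$ a half-twist). For $A\subseteq E(G)$, $G^{\tau(A)}$ is the result of doing this for every edge in $A$. *Penrose-contraction:* $G\rightthreetimes e:=G^{\tau(e)}/e$. *(Geometric) dual:* $G^*=(V(G^* ),E(G))$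 is the ribbon graph obtained by capping off the holes (boundary components) of $G$ with a set of discs, denoted $V(G^* )$, and then removing the original vertices. The chromatic polynomial of a ribbon graph is that of its underlying abstract graph (for natural $k$, $\chi(H;k)$ is the number of proper vertex $k$-colourings; it is $0$ if $H$ has a loop). **Edge-point ribbon graphs.** An edge-point ribbon graph is an object obtained from a ribbon graph $(V,E)$ by contracting each edge (disc) in some (possibly empty) subset of $E$ to a point; the points so created are singular points and the images of the other edges are its edges. Equivalently, it is an edge 2-coloured ribbon graph in which dark grey edges represent those contracted to points and light grey edges are the edges of the edge-point ribbon graph (considered up to partial Petrials of dark grey edges). Ribbon graphs are the edge-point ribbon graphs with no singular points. Deletion, contraction and Penrose-contraction are inherited by performing the ribbon graph operations on light grey edges in the 2-coloured model. $G\odot e$ is obtained by contracting $e$ to a point (recolouring $e$ dark grey). **The polynomial $\Omega$.** $\Omega(G)=\Omega(G;w,x,y,z,t)\in\mathbb{Z}[w,x,y,z,t]$ is the polynomial of edge-point ribbon graphs defined by $\Omega(G)=w\,\Omega(G\odot e)+x\,\Omega(G/e)+y\,\Omega(G\setminus e)+z\,\Omega(G\rightthreetimes e)$ for any edge $e$, and $\Omega(G)=t^{\kappa(G)}$ if $G$ is edgeless, where $\kappa(G)$ is the number of connected components. *)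

theory Defs
  imports Main "HOL-Library.FuncSet" "HOL-Library.Poly_Mapping"
    "HOL-Computational_Algebra.Polynomial"
begin

section \<open>Ribbon graphs\<close>

text \<open>
  Ribbon graphs are encoded by the way their discs are glued, which determines the surface up to
  equivalence. An edge disc \<open>e\<close> meets the vertices in two line segments, its ends. View the edge
  disc as a rectangle whose two remaining boundary arcs are called its sides; then
  \<open>(e, i, s)\<close> is the corner of \<open>e\<close> lying on end \<open>i\<close> and side \<open>s\<close>.

  Removing the ends of the edges from the boundary circle of a vertex leaves either a collection of
  arcs, each joining two corners, or (when no edge meets the vertex) the whole circle. The
  map \<open>arc G\<close> exchanges the two endpoints of every such arc, and \<open>isolated G\<close> is the number
  of vertices that meet no edge. Thus the boundary of a vertex that meets an edge is traversed by
  alternately following an arc and crossing an end of an edge.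
\<close>

type_synonym 'e corner = "'e \<times> bool \<times> bool"

record 'e ribbon =
  edges :: "'e set"
  arc :: "'e corner \<Rightarrow> 'e corner"
  isolated :: nat

definition corners :: "'e ribbon \<Rightarrow> 'e corner set" where
  "corners G = edges G \<times> UNIV"

text \<open>Outside the corners of \<open>G\<close> the map \<open>arc G\<close> is the identity, by convention.\<close>

definition ribbon_graph :: "'e ribbon \<Rightarrow> bool" where
  "ribbon_graph G \<longleftrightarrow>
     finite (edges G) \<and>
     (\<forall>c\<in>corners G. arc G c \<in> corners G \<and> arc G c \<noteq> c \<and> arc G (arc G c) = c) \<and>
     (\<forall>c. c \<notin> corners G \<longrightarrow> arc G c = c)"

subsection \<open>The underlying abstract graph\<close>

definition vertex_boundary :: "'e ribbon \<Rightarrow> 'e corner \<Rightarrow> 'e corner set" where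
  "vertex_boundary G c =
     {d. (c, d) \<in> ({(a, arc G a) |a. True} \<union> {((e, i, s), (e, i, \<not> s)) |e i s. True})\<^sup>*}"

text \<open>A vertex that meets an edge is identified with the set of corners on its boundary.\<close>

datatype 'e vertex = Boundary "'e corner set" | Isolated nat

definition end_vertex :: "'e ribbon \<Rightarrow> 'e \<Rightarrow> bool \<Rightarrow> 'e vertex" where
  "end_vertex G e i = Boundary (vertex_boundary G (e, i, False))"

definition vertices :: "'e ribbon \<Rightarrow> 'e vertex set" where
  "vertices G = {end_vertex G e i |e i. e \<in> edges G} \<union> Isolated ` {..<isolated G}"

definition connected_vertices :: "'e ribbon \<Rightarrow> ('e vertex \<times> 'e vertex) set" where
  "connected_vertices G = {(end_vertex G e i, end_vertex G e j) |e i j. e \<in> edges G}\<^sup>*"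

definition num_components :: "'e ribbon \<Rightarrow> nat" where
  "num_components G = card (vertices G // connected_vertices G)"

definition proper_colourings :: "'e ribbon \<Rightarrow> nat \<Rightarrow> ('e vertex \<Rightarrow> nat) set" where
  "proper_colourings G k =
     {c \<in> vertices G \<rightarrow>\<^sub>E {..<k}.
        \<forall>e\<in>edges G. c (end_vertex G e False) \<noteq> c (end_vertex G e True)}"

definition chromatic_poly :: "'e ribbon \<Rightarrow> int poly" where
  "chromatic_poly G = (THE p. \<forall>k. poly p (int k) = int (card (proper_colourings G k)))"

subsection \<open>Operations\<close>

text \<open>
  \<open>join_arcs a b G\<close> removes the corners \<open>a\<close> and \<open>b\<close> and connects the vertex boundary
  arcs ending there along a curve from \<open>a\<close> to \<open>b\<close>. If \<open>a\<close> and \<open>b\<close> are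
  the two endpoints of one arc, this closes up to a circle without corners, which bounds an isolated
  vertex.
\<close>

definition join_arcs :: "'e corner \<Rightarrow> 'e corner \<Rightarrow> 'e ribbon \<Rightarrow> 'e ribbon" where
  "join_arcs a b G =
     G\<lparr>arc := (arc G)(arc G a := arc G b, arc G b := arc G a, a := a, b := b),
       isolated := isolated G + (if arc G a = b then 1 else 0)\<rparr>"

text \<open>
  Deleting \<open>e\<close> leaves the vertex boundaries as they were, so they now run along the former
  ends of \<open>e\<close>. The boundary components of the union of \<open>e\<close> with its incident vertices, which
  bound the new vertices created by contraction, run along the two sides of \<open>e\<close> instead.
\<close>

definition delete_edge :: "'e \<Rightarrow> 'e ribbon \<Rightarrow> 'e ribbon" where
  "delete_edge e G =
     (join_arcs (e, False, False) (e, False, True)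
       (join_arcs (e, True, False) (e, True, True) G))\<lparr>edges := edges G - {e}\<rparr>"

definition contract_edge :: "'e \<Rightarrow> 'e ribbon \<Rightarrow> 'e ribbon" where
  "contract_edge e G =
     (join_arcs (e, False, False) (e, True, False)
       (join_arcs (e, False, True) (e, True, True) G))\<lparr>edges := edges G - {e}\<rparr>"

text \<open>Every edge of \<open>A\<close> is detached at its end \<open>True\<close> and reattached there in reverse.\<close>

definition reverse_end :: "'e set \<Rightarrow> 'e corner \<Rightarrow> 'e corner" where
  "reverse_end A = (\<lambda>(e, i, s). (e, i, if e \<in> A \<and> i then \<not> s else s))"

definition partial_petrial :: "'e set \<Rightarrow> 'e ribbon \<Rightarrow> 'e ribbon" where
  "partial_petrial A G = G\<lparr>arc := reverse_end A \<circ> arc G \<circ> reverse_end A\<rparr>"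

definition penrose_contract :: "'e \<Rightarrow> 'e ribbon \<Rightarrow> 'e ribbon" where
  "penrose_contract e G = contract_edge e (partial_petrial {e} G)"

text \<open>
  The boundary components of \<open>G\<close> alternate between vertex arcs and sides of edges. Capping them off
  and removing the vertices makes the sides of each edge its ends and vice versa; the arcs
  are unchanged. The single boundary component of an isolated vertex yields an isolated vertex.
\<close>

definition exchange_ends_sides :: "'e corner \<Rightarrow> 'e corner" where
  "exchange_ends_sides = (\<lambda>(e, i, s). (e, s, i))"

definition geometric_dual :: "'e ribbon \<Rightarrow> 'e ribbon" where
  "geometric_dual G = G\<lparr>arc := exchange_ends_sides \<circ> arc G \<circ> exchange_ends_sides\<rparr>"

section \<open>Edge-point ribbon graphs and the polynomial \<open>\<Omega>\<close>\<close>

text \<open>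
  An edge-point ribbon graph is represented by an edge 2-coloured ribbon graph \<open>(G, D)\<close>, where
  \<open>D\<close> is the set of dark grey edges, standing for singular points, and \<open>edges G - D\<close> is the
  set of light grey edges, which are the edges of the edge-point ribbon graph.
\<close>

type_synonym 'e edge_point = "'e ribbon \<times> 'e set"

definition edge_point_ribbon_graph :: "'e edge_point \<Rightarrow> bool" where
  "edge_point_ribbon_graph = (\<lambda>(G, D). ribbon_graph G \<and> D \<subseteq> edges G)"

text \<open>The elements of \<open>omega_ring\<close> are the polynomials in five variables with integer coefficients.\<close>

datatype omega_var = Var_w | Var_x | Var_y | Var_z | Var_t

type_synonym omega_ring = "(omega_var \<Rightarrow>\<^sub>0 nat) \<Rightarrow>\<^sub>0 int"

definition indeterminate :: "omega_var \<Rightarrow> omega_ring" where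
  "indeterminate v = Poly_Mapping.single (Poly_Mapping.single v 1) 1"

definition eval_omega_ring :: "omega_ring \<Rightarrow> 'r \<Rightarrow> 'r \<Rightarrow> 'r \<Rightarrow> 'r \<Rightarrow> 'r \<Rightarrow> 'r::comm_ring_1" where
  "eval_omega_ring p w x y z t =
     (\<Sum>m\<in>Poly_Mapping.keys p. of_int (Poly_Mapping.lookup p m) *
        w ^ Poly_Mapping.lookup m Var_w * x ^ Poly_Mapping.lookup m Var_x *
        y ^ Poly_Mapping.lookup m Var_y * z ^ Poly_Mapping.lookup m Var_z *
        t ^ Poly_Mapping.lookup m Var_t)"

text \<open>
  The connected components in the edgeless case are those of the 2-coloured ribbon graph, since
  contracting an edge to a point does not disconnect its ends. The first conjunct
  only serves to make the function unique.
\<close>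

definition satisfies_omega_recursion :: "('e edge_point \<Rightarrow> omega_ring) \<Rightarrow> bool" where
  "satisfies_omega_recursion f \<longleftrightarrow>
     (\<forall>H. \<not> edge_point_ribbon_graph H \<longrightarrow> f H = 0) \<and>
     (\<forall>G D e. edge_point_ribbon_graph (G, D) \<and> e \<in> edges G - D \<longrightarrow>
        f (G, D) = indeterminate Var_w * f (G, insert e D)
                 + indeterminate Var_x * f (contract_edge e G, D)
                 + indeterminate Var_y * f (delete_edge e G, D)
                 + indeterminate Var_z * f (penrose_contract e G, D)) \<and>
     (\<forall>G D. edge_point_ribbon_graph (G, D) \<and> edges G - D = {} \<longrightarrow>
        f (G, D) = indeterminate Var_t ^ num_components G)"

definition Omega :: "'e edge_point \<Rightarrow> omega_ring" where
  "Omega = (THE f. satisfies_omega_recursion f)"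

end

theory Submission
  imports Defs
begin

text \<open>
  Both sides are polynomials in \<open>\<lambda>\<close>, so it suffices to compare them at every natural number
  \<open>k\<close>, and there both sides count colourings of one fixed set, the corners of \<open>G\<close>, with
  \<open>k\<close> colours. All colourings considered are constant along the arcs. Each operation on
  an edge \<open>e\<close> amounts to a condition on the four colours at the corners of \<open>e\<close>: deleting
  \<open>e\<close> forces the two corners on each end to agree, contracting it forces the two corners on each
  side to agree, Penrose-contraction forces corners on opposite ends and opposite sides to agree,
  and contracting \<open>e\<close> to a point, when only connected components are counted, forces all four
  to agree. The components of the result are the regions of the pattern of arcs
  and local connections, and \<open>k\<close> to the number of regions counts the colourings that meet the
  condition at every edge (\<open>power_regions\<close>).

  Choosing one of the four operations at every edge, a state, gives an explicit sum over states
  that satisfies the recursion of \<open>\<Omega>\<close>; since the recursion determines its solution, the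
  sum is \<open>\<Omega>\<close> (\<open>Omega_eq_state_sum\<close>). Exchanging the sum over states with the sum over
  colourings turns the value at \<open>\<lambda> = k\<close> into a sum over colourings of a product over
  edges (\<open>poly_weighted_state_sum\<close>). For the weights \<open>(-2, 1, 0, 1)\<close> the factor of \<open>e\<close> is
  \<open>[contraction] + [Penrose] - 2 [all four agree]\<close>, where a bracket is \<open>1\<close> if the condition holds and
  \<open>0\<close> otherwise. All four colours agree exactly when both conditions hold, and then the factor
  vanishes. When one of the two conditions holds but not the other, the two corners on each end of
  \<open>e\<close> have different colours. So the factor is the sum of the first two brackets, each restricted to
  colourings in which they differ. Expanding the product over the edges, with \<open>A\<close>
  the set of edges at which the Penrose condition is chosen, gives a sum over
  \<open>A\<close>. The twist of the partial Petrial and the exchange of ends and sides in the dual translate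
  the summand of \<open>A\<close> into proper colourings of the dual of the partial Petrial: the boundary
  components of the partial Petrial are coloured, and every edge separates different colours
  (\<open>card_proper_colourings_dual_petrial\<close>).
\<close>

section \<open>Joining the arcs of an involution\<close>

definition fixpoint_free_involution :: "'a set \<Rightarrow> ('a \<Rightarrow> 'a) \<Rightarrow> bool" where
  "fixpoint_free_involution K \<alpha> \<longleftrightarrow> (\<forall>c\<in>K. \<alpha> c \<in> K \<and> \<alpha> c \<noteq> c \<and> \<alpha> (\<alpha> c) = c)"

definition invariant_colourings :: "'a set \<Rightarrow> ('a \<Rightarrow> 'a) \<Rightarrow> nat \<Rightarrow> ('a \<Rightarrow> nat) set" where
  "invariant_colourings K \<alpha> k = {\<phi> \<in> K \<rightarrow>\<^sub>E {..<k}. \<forall>c\<in>K. \<phi> (\<alpha> c) = \<phi> c}"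

text \<open>
  The effect of \<open>join_arcs\<close> on the arcs alone, over an arbitrary set of corners: an edge is removed by
  two joins, and between them two corners of the edge are left over, which no ribbon graph has.
\<close>

definition joined_arcs :: "'a \<Rightarrow> 'a \<Rightarrow> ('a \<Rightarrow> 'a) \<Rightarrow> 'a \<Rightarrow> 'a" where
  "joined_arcs a b \<alpha> = \<alpha>(\<alpha> a := \<alpha> b, \<alpha> b := \<alpha> a, a := a, b := b)"

lemma mem_invariant_colourings:
  "\<phi> \<in> invariant_colourings K \<alpha> k \<longleftrightarrow>
     (\<forall>c\<in>K. \<phi> c < k \<and> \<phi> (\<alpha> c) = \<phi> c) \<and> (\<forall>c. c \<notin> K \<longrightarrow> \<phi> c = undefined)"
  by (auto simp: invariant_colourings_def PiE_def extensional_def Pi_def)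

lemma finite_invariant_colourings:
  "finite K \<Longrightarrow> finite (invariant_colourings K \<alpha> k)"
  unfolding invariant_colourings_def by (simp add: finite_PiE)

lemma fixpoint_free_involution_joined_arcs:
  assumes "fixpoint_free_involution K \<alpha>" "a \<in> K" "b \<in> K" "a \<noteq> b"
  shows "fixpoint_free_involution (K - {a, b}) (joined_arcs a b \<alpha>)"
  using assms unfolding fixpoint_free_involution_def joined_arcs_def
  by (smt (verit, ccfv_threshold) Diff_iff fun_upd_apply insert_iff empty_iff)

lemma joined_arcs_outside:
  assumes "fixpoint_free_involution K \<alpha>" "a \<in> K" "b \<in> K"
    and "\<And>c. c \<notin> K \<Longrightarrow> \<alpha> c = c" and "c \<notin> K - {a, b}"
  shows "joined_arcs a b \<alpha> c = c"
proof (cases "c = a \<or> c = b")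
  case False
  then have "c \<notin> K" using assms(5) by simp
  moreover from this have "c \<noteq> \<alpha> a" "c \<noteq> \<alpha> b"
    using assms(1-3) unfolding fixpoint_free_involution_def by blast+
  ultimately show ?thesis using False assms(4) by (simp add: joined_arcs_def)
qed (auto simp: joined_arcs_def)

text \<open>
  A colouring with equal colours at \<open>a\<close> and \<open>b\<close> gives one and the same colour to the two arcs that
  the join merges, so it descends to the remaining corners, and the colours at \<open>a\<close> and \<open>b\<close> can be
  read off there from the other endpoints of the arcs. The exception is an arc from \<open>a\<close> to \<open>b\<close>: it
  closes up to a circle, whose colour is free and accounts for the factor \<open>k\<close>. The hypothesis on \<open>P\<close>
  says that \<open>P\<close> depends only on the colours away from \<open>a\<close> and \<open>b\<close>.
\<close>

lemma card_invariant_colourings_joined_arcs: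
  assumes inv: "fixpoint_free_involution K \<alpha>" and ab: "a \<in> K" "b \<in> K" "a \<noteq> b"
    and local: "\<And>\<phi>. P (restrict \<phi> (K - {a, b})) = P \<phi>"
  shows "card {\<phi> \<in> invariant_colourings K \<alpha> k. \<phi> a = \<phi> b \<and> P \<phi>} =
    (if \<alpha> a = b then k else 1) *
    card {\<phi> \<in> invariant_colourings (K - {a, b}) (joined_arcs a b \<alpha>) k. P \<phi>}"
    (is "card ?X = _ * card ?Y")
proof -
  let ?K = "K - {a, b}" and ?\<beta> = "joined_arcs a b \<alpha>"
  have \<alpha>: "\<alpha> c \<in> K" "\<alpha> c \<noteq> c" "\<alpha> (\<alpha> c) = c" if "c \<in> K" for c
    using inv that unfolding fixpoint_free_involution_def by auto
  have P: "P \<phi> = P \<psi>" if "\<And>c. c \<in> ?K \<Longrightarrow> \<phi> c = \<psi> c" for \<phi> \<psi>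
    using local[of \<phi>] local[of \<psi>] restrict_ext[of ?K \<phi> \<psi>] that by metis
  show ?thesis
  proof (cases "\<alpha> a = b")
    case True
    then have \<alpha>b: "\<alpha> b = a" using \<alpha>[of a] ab by auto
    have \<beta>: "?\<beta> c = \<alpha> c" if "c \<in> ?K" for c
      using that True \<alpha>b by (auto simp: joined_arcs_def)
    have \<alpha>K: "\<alpha> c \<in> ?K" if "c \<in> ?K" for c
      using that \<alpha>[of c] True \<alpha>b by auto
    let ?f = "\<lambda>\<phi>. (\<phi> a, restrict \<phi> ?K)" and ?g = "\<lambda>(j, \<phi>). \<phi>(a := j, b := j)"
    have "bij_betw ?f ?X ({..<k} \<times> ?Y)"
    proof (rule bij_betw_byWitness[where f' = ?g])
      show "\<forall>\<phi>\<in>?X. ?g (?f \<phi>) = \<phi>"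
        by (auto simp: fun_eq_iff invariant_colourings_def PiE_def extensional_def)
      show "\<forall>x\<in>{..<k} \<times> ?Y. ?f (?g x) = x"
        using ab by (auto simp: fun_eq_iff invariant_colourings_def PiE_def extensional_def)
      show "?f ` ?X \<subseteq> {..<k} \<times> ?Y"
      proof (rule image_subsetI)
        fix \<phi> assume "\<phi> \<in> ?X"
        then have \<phi>: "\<phi> \<in> invariant_colourings K \<alpha> k" "\<phi> a = \<phi> b" "P \<phi>" by auto
        have "restrict \<phi> ?K (?\<beta> c) = restrict \<phi> ?K c" if "c \<in> ?K" for c
          using that \<phi>(1) \<alpha>K[OF that] \<beta>[OF that] by (simp add: invariant_colourings_def)
        then show "?f \<phi> \<in> {..<k} \<times> ?Y"
          using \<phi> ab local by (auto simp: invariant_colourings_def PiE_def Pi_def)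
      qed
      show "?g ` ({..<k} \<times> ?Y) \<subseteq> ?X"
      proof (rule image_subsetI)
        fix x assume x: "x \<in> {..<k} \<times> ?Y"
        obtain j \<phi> where x_eq: "x = (j, \<phi>)" by (cases x)
        then have j: "j < k" and \<phi>: "\<phi> \<in> invariant_colourings ?K ?\<beta> k" "P \<phi>" using x by auto
        have "P (\<phi>(a := j, b := j))" using \<phi>(2) P[of "\<phi>(a := j, b := j)" \<phi>] by auto
        moreover have "\<phi>(a := j, b := j) \<in> invariant_colourings K \<alpha> k"
          unfolding invariant_colourings_def
        proof (intro CollectI conjI ballI)
          show "\<phi>(a := j, b := j) \<in> K \<rightarrow>\<^sub>E {..<k}"
            using j \<phi>(1) ab by (auto simp: invariant_colourings_def PiE_def extensional_def Pi_def)
          fix c assume c: "c \<in> K"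
          show "(\<phi>(a := j, b := j)) (\<alpha> c) = (\<phi>(a := j, b := j)) c"
          proof (cases "c \<in> ?K")
            case True
            then have "\<phi> (?\<beta> c) = \<phi> c" using \<phi>(1) unfolding invariant_colourings_def by blast
            then show ?thesis using True \<beta>[OF True] \<alpha>K[OF True] by simp
          next
            case False
            then show ?thesis using c True \<alpha>b by auto
          qed
        qed
        ultimately show "?g x \<in> ?X" by (simp add: x_eq)
      qed
    qed
    from bij_betw_same_card[OF this] show ?thesis using True by (simp add: card_cartesian_product)
  next
    case False
    have K: "\<alpha> a \<in> ?K" "\<alpha> b \<in> ?K" using \<alpha>[of a] \<alpha>[of b] ab False by auto
    have \<beta>: "?\<beta> (\<alpha> a) = \<alpha> b" "?\<beta> (\<alpha> b) = \<alpha> a"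
      using K \<alpha>(3)[of a] \<alpha>(3)[of b] ab by (auto simp: joined_arcs_def)
    have \<beta>': "?\<beta> c = \<alpha> c" "\<alpha> c \<in> ?K" if "c \<in> ?K" "c \<noteq> \<alpha> a" "c \<noteq> \<alpha> b" for c
      using that \<alpha>[of c] by (auto simp: joined_arcs_def)
    let ?g = "\<lambda>\<phi>. \<phi>(a := \<phi> (\<alpha> a), b := \<phi> (\<alpha> b))"
    have "bij_betw (\<lambda>\<phi>. restrict \<phi> ?K) ?X ?Y"
    proof (rule bij_betw_byWitness[where f' = ?g])
      show "\<forall>\<phi>\<in>?X. ?g (restrict \<phi> ?K) = \<phi>"
        using K ab by (auto simp: fun_eq_iff invariant_colourings_def PiE_def extensional_def)
      show "\<forall>\<phi>\<in>?Y. restrict (?g \<phi>) ?K = \<phi>"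
        by (auto simp: fun_eq_iff invariant_colourings_def PiE_def extensional_def)
      show "(\<lambda>\<phi>. restrict \<phi> ?K) ` ?X \<subseteq> ?Y"
      proof (rule image_subsetI)
        fix \<phi> assume "\<phi> \<in> ?X"
        then have \<phi>: "\<phi> \<in> invariant_colourings K \<alpha> k" "\<phi> a = \<phi> b" "P \<phi>" by auto
        then have \<phi>': "\<phi> (\<alpha> c) = \<phi> c" if "c \<in> K" for c
          using that by (auto simp: invariant_colourings_def)
        have "restrict \<phi> ?K (?\<beta> c) = restrict \<phi> ?K c" if "c \<in> ?K" for c
          using that K \<beta> \<beta>'[of c] \<phi>' ab \<phi>(2)
          by (cases "c = \<alpha> a \<or> c = \<alpha> b") auto
        then show "restrict \<phi> ?K \<in> ?Y"
          using \<phi> local by (auto simp: invariant_colourings_def PiE_def Pi_def)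
      qed
      show "?g ` ?Y \<subseteq> ?X"
      proof (rule image_subsetI)
        fix \<phi> assume "\<phi> \<in> ?Y"
        then have \<phi>: "\<phi> \<in> invariant_colourings ?K ?\<beta> k" "P \<phi>" by auto
        then have \<phi>': "\<phi> (?\<beta> c) = \<phi> c" if "c \<in> ?K" for c
          using that by (auto simp: invariant_colourings_def)
        have eq: "\<phi> (\<alpha> a) = \<phi> (\<alpha> b)" using \<phi>'[OF K(1)] \<beta> by simp
        have "P (?g \<phi>)" using \<phi>(2) P[of "?g \<phi>" \<phi>] by auto
        moreover have "?g \<phi> \<in> invariant_colourings K \<alpha> k"
          unfolding invariant_colourings_def
        proof (intro CollectI conjI ballI)
          show "?g \<phi> \<in> K \<rightarrow>\<^sub>E {..<k}"
            using K \<phi>(1) ab by (auto simp: invariant_colourings_def PiE_def extensional_def Pi_def)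
          fix c assume c: "c \<in> K"
          consider "c = a \<or> c = b" | "c = \<alpha> a \<or> c = \<alpha> b" | "c \<in> ?K" "c \<noteq> \<alpha> a" "c \<noteq> \<alpha> b"
            using c by auto
          then show "?g \<phi> (\<alpha> c) = ?g \<phi> c"
          proof cases
            case 1 then show ?thesis using K ab eq by auto
          next
            case 2 then show ?thesis using K ab eq \<alpha>(3)[of a] \<alpha>(3)[of b] by auto
          next
            case 3 then show ?thesis using \<beta>'[of c] \<phi>'[of c] by auto
          qed
        qed
        ultimately show "?g \<phi> \<in> ?X" using eq by auto
      qed
    qed
    from bij_betw_same_card[OF this] show ?thesis using False by simp
  qed
qed

section \<open>Local counts of corner colourings\<close>

text \<open>
  \<open>C\<close> assigns to every edge a condition on the colours of its four corners, given as a function of end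
  and side. The power of \<open>k\<close> counts the colours of the isolated vertices.
\<close>

definition num_colourings ::
    "'e ribbon \<Rightarrow> ('e \<Rightarrow> (bool \<times> bool \<Rightarrow> nat) \<Rightarrow> bool) \<Rightarrow> nat \<Rightarrow> nat" where
  "num_colourings G C k = k ^ isolated G *
     card {\<phi> \<in> invariant_colourings (corners G) (arc G) k. \<forall>e\<in>edges G. C e (\<lambda>p. \<phi> (e, p))}"

lemma ribbon_graph_iff:
  "ribbon_graph G \<longleftrightarrow> finite (edges G) \<and> fixpoint_free_involution (corners G) (arc G) \<and>
     (\<forall>c. c \<notin> corners G \<longrightarrow> arc G c = c)"
  by (simp add: ribbon_graph_def fixpoint_free_involution_def)

lemma finite_corners: "ribbon_graph G \<Longrightarrow> finite (corners G)"
  by (simp add: ribbon_graph_def corners_def)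

lemma mem_corners: "(e, p) \<in> corners G \<longleftrightarrow> e \<in> edges G"
  by (simp add: corners_def)

lemma arc_corners:
  assumes "ribbon_graph G" "c \<in> corners G"
  shows "arc G c \<in> corners G" "arc G (arc G c) = c"
  using assms by (auto simp: ribbon_graph_def)

lemma arc_outside: "ribbon_graph G \<Longrightarrow> c \<notin> corners G \<Longrightarrow> arc G c = c"
  unfolding ribbon_graph_def by blast

lemma num_colourings_cong:
  assumes "\<And>e f. e \<in> edges G \<Longrightarrow> C e f = C' e f"
  shows "num_colourings G C k = num_colourings G C' k"
  using assms by (simp add: num_colourings_def cong: conj_cong)

lemma join_arcs_sel [simp]:
  "edges (join_arcs a b G) = edges G"
  "arc (join_arcs a b G) = joined_arcs a b (arc G)"
  "isolated (join_arcs a b G) = isolated G + (if arc G a = b then 1 else 0)"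
  by (simp_all add: join_arcs_def joined_arcs_def)

text \<open>
  The common form of deletion and contraction: the four corners of \<open>e\<close> are joined in two pairs.
\<close>

definition remove_edge ::
    "'e \<Rightarrow> bool \<times> bool \<Rightarrow> bool \<times> bool \<Rightarrow> bool \<times> bool \<Rightarrow> bool \<times> bool \<Rightarrow> 'e ribbon \<Rightarrow> 'e ribbon" where
  "remove_edge e p q p' q' G =
     (join_arcs (e, p) (e, q) (join_arcs (e, p') (e, q') G))\<lparr>edges := edges G - {e}\<rparr>"

lemma edges_remove_edge [simp]: "edges (remove_edge e p q p' q' G) = edges G - {e}"
  by (simp add: remove_edge_def)

text \<open>
  Removing an edge turns into a condition at that edge, so that colourings of the smaller ribbon graph
  can be counted on the corners of the original one. The two joins contribute one pair of
  equal colours each.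
\<close>

lemma
  assumes G: "ribbon_graph G" and e: "e \<in> edges G"
    and UNIV: "{p, q, p', q'} = UNIV" and distinct: "distinct [p, q, p', q']"
  shows ribbon_graph_remove_edge: "ribbon_graph (remove_edge e p q p' q' G)"
    and num_colourings_remove_edge: "num_colourings (remove_edge e p q p' q' G) C k =
      num_colourings G (C(e := \<lambda>f. f p = f q \<and> f p' = f q')) k"
proof -
  let ?H = "remove_edge e p q p' q' G"
  let ?\<alpha> = "arc G" and ?\<beta> = "joined_arcs (e, p') (e, q') (arc G)"
  let ?\<gamma> = "joined_arcs (e, p) (e, q) ?\<beta>"
  let ?K = "corners G - {(e, p'), (e, q')}"
  let ?L = "?K - {(e, p), (e, q)}"
  have L: "?L = corners ?H" using UNIV by (auto simp: corners_def)
  have \<alpha>: "fixpoint_free_involution (corners G) ?\<alpha>" using G by (simp add: ribbon_graph_iff)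
  have \<beta>: "fixpoint_free_involution ?K ?\<beta>"
    using e distinct by (intro fixpoint_free_involution_joined_arcs[OF \<alpha>]) (auto simp: mem_corners)
  have \<gamma>: "fixpoint_free_involution ?L ?\<gamma>"
    using e distinct by (intro fixpoint_free_involution_joined_arcs[OF \<beta>]) (auto simp: mem_corners)
  have \<alpha>_out: "?\<alpha> c = c" if "c \<notin> corners G" for c using arc_outside[OF G that] .
  have \<beta>_out: "?\<beta> c = c" if "c \<notin> ?K" for c
    using that e by (intro joined_arcs_outside[OF \<alpha> _ _ \<alpha>_out]) (auto simp: mem_corners)
  have \<gamma>_out: "?\<gamma> c = c" if "c \<notin> ?L" for c
    using that e distinct
    by (intro joined_arcs_outside[OF \<beta> _ _ \<beta>_out]) (auto simp: mem_corners)
  have arcH: "arc ?H = ?\<gamma>" by (simp add: remove_edge_def)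
  show "ribbon_graph ?H"
    using G \<gamma> \<gamma>_out unfolding ribbon_graph_iff arcH L by simp
  \<comment> \<open>The conditions at the remaining edges; they do not see the corners that are joined.\<close>
  define Q where "Q \<phi> \<longleftrightarrow> (\<forall>d\<in>edges G - {e}. C d (\<lambda>p. \<phi> (d, p)))" for \<phi>
  have Q1: "Q (restrict \<phi> ?L) = Q \<phi>" for \<phi> unfolding Q_def L by (simp add: mem_corners)
  have Q2: "(restrict \<phi> ?K (e, p) = restrict \<phi> ?K (e, q) \<and> Q (restrict \<phi> ?K)) =
      (\<phi> (e, p) = \<phi> (e, q) \<and> Q \<phi>)" for \<phi>
    unfolding Q_def using e distinct by (simp add: mem_corners)
  have set: "{\<phi> \<in> invariant_colourings (corners G) ?\<alpha> k. \<forall>d\<in>edges G.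
        (C(e := \<lambda>f. f p = f q \<and> f p' = f q')) d (\<lambda>p. \<phi> (d, p))} =
      {\<phi> \<in> invariant_colourings (corners G) ?\<alpha> k. \<phi> (e, p') = \<phi> (e, q') \<and>
        \<phi> (e, p) = \<phi> (e, q) \<and> Q \<phi>}"
    using e by (auto simp: Q_def)
  have "num_colourings G (C(e := \<lambda>f. f p = f q \<and> f p' = f q')) k = k ^ isolated G *
      ((if ?\<alpha> (e, p') = (e, q') then k else 1) *
        card {\<phi> \<in> invariant_colourings ?K ?\<beta> k. \<phi> (e, p) = \<phi> (e, q) \<and> Q \<phi>})"
    unfolding num_colourings_def set
    using e distinct Q2 by (subst card_invariant_colourings_joined_arcs[OF \<alpha>]) (auto simp: mem_corners)
  also have "card {\<phi> \<in> invariant_colourings ?K ?\<beta> k. \<phi> (e, p) = \<phi> (e, q) \<and> Q \<phi>} =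
      (if ?\<beta> (e, p) = (e, q) then k else 1) * card {\<phi> \<in> invariant_colourings ?L ?\<gamma> k. Q \<phi>}"
    using e distinct Q1 by (subst card_invariant_colourings_joined_arcs[OF \<beta>]) (auto simp: mem_corners)
  finally have G_count: "num_colourings G (C(e := \<lambda>f. f p = f q \<and> f p' = f q')) k =
      k ^ isolated G * ((if ?\<alpha> (e, p') = (e, q') then k else 1) *
        ((if ?\<beta> (e, p) = (e, q) then k else 1) *
          card {\<phi> \<in> invariant_colourings ?L ?\<gamma> k. Q \<phi>}))" .
  have "isolated ?H = isolated G + (if ?\<alpha> (e, p') = (e, q') then 1 else 0) +
      (if ?\<beta> (e, p) = (e, q) then 1 else 0)"
    by (simp add: remove_edge_def)
  moreover have "num_colourings ?H C k =
      k ^ isolated ?H * card {\<phi> \<in> invariant_colourings ?L ?\<gamma> k. Q \<phi>}"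
    unfolding num_colourings_def arcH L Q_def by simp
  ultimately show "num_colourings ?H C k =
      num_colourings G (C(e := \<lambda>f. f p = f q \<and> f p' = f q')) k"
    unfolding G_count by (auto simp: power_add)
qed

text \<open>
  Partial Petrials and duals only rename the corners of each edge. Colourings are transported along the
  renaming, and the condition at each edge is renamed with them.
\<close>

definition relabel_corners :: "('e \<Rightarrow> bool \<times> bool \<Rightarrow> bool \<times> bool) \<Rightarrow> 'e corner \<Rightarrow> 'e corner" where
  "relabel_corners \<rho> = (\<lambda>(e, p). (e, \<rho> e p))"

lemma
  assumes G: "ribbon_graph G" and \<rho>: "\<And>e p. \<rho> e (\<rho> e p) = p"
    and H: "H = G\<lparr>arc := relabel_corners \<rho> \<circ> arc G \<circ> relabel_corners \<rho>\<rparr>"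
  shows ribbon_graph_relabel: "ribbon_graph H"
    and num_colourings_relabel: "num_colourings H C k = num_colourings G (\<lambda>e f. C e (f \<circ> \<rho> e)) k"
proof -
  let ?r = "relabel_corners \<rho>"
  have r: "?r (?r c) = c" for c by (cases c) (simp add: relabel_corners_def \<rho>)
  have rK: "?r c \<in> corners G \<longleftrightarrow> c \<in> corners G" for c by (cases c) (simp add: relabel_corners_def mem_corners)
  have K: "corners H = corners G" using H by (simp add: corners_def)
  have [simp]: "edges H = edges G" "isolated H = isolated G" using H by auto
  have arcH: "arc H = ?r \<circ> arc G \<circ> ?r" using H by auto
  show "ribbon_graph H"
    unfolding ribbon_graph_def K
  proof (intro conjI ballI allI impI)
    show "finite (edges H)" using G by (simp add: ribbon_graph_def)
    fix c
    show "arc H c = c" if "c \<notin> corners G"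
      using arc_outside[OF G, of "?r c"] that rK[of c] r by (simp add: arcH)
    assume c: "c \<in> corners G"
    then have "arc G (?r c) \<in> corners G" "arc G (?r c) \<noteq> ?r c" "arc G (arc G (?r c)) = ?r c"
      using G rK by (auto simp: ribbon_graph_def)
    then show "arc H c \<in> corners G" "arc H c \<noteq> c" "arc H (arc H c) = c"
      using rK[of "arc G (?r c)"] r[of "arc G (?r c)"] r[of c] by (auto simp only: arcH o_apply)
  qed
  have aG: "arc G c \<in> corners G" if "c \<in> corners G" for c
    using G that by (simp add: ribbon_graph_def)
  let ?X = "{\<phi> \<in> invariant_colourings (corners H) (arc H) k. \<forall>e\<in>edges G. C e (\<lambda>p. \<phi> (e, p))}"
  let ?Y = "{\<phi> \<in> invariant_colourings (corners G) (arc G) k.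
     \<forall>e\<in>edges G. C e ((\<lambda>p. \<phi> (e, p)) \<circ> \<rho> e)}"
  have rp: "?r (e, p) = (e, \<rho> e p)" for e p by (simp add: relabel_corners_def)
  have "bij_betw (\<lambda>\<phi>. \<phi> \<circ> ?r) ?X ?Y"
  proof (rule bij_betw_byWitness[where f' = "\<lambda>\<phi>. \<phi> \<circ> ?r"])
    show "\<forall>\<phi>\<in>?X. \<phi> \<circ> ?r \<circ> ?r = \<phi>" "\<forall>\<phi>\<in>?Y. \<phi> \<circ> ?r \<circ> ?r = \<phi>" by (auto simp: r)
    show "(\<lambda>\<phi>. \<phi> \<circ> ?r) ` ?X \<subseteq> ?Y"
    proof (rule image_subsetI)
      fix \<phi> assume "\<phi> \<in> ?X"
      then have \<phi>: "\<phi> \<in> invariant_colourings (corners H) (arc H) k"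
        "\<forall>e\<in>edges G. C e (\<lambda>p. \<phi> (e, p))" by auto
      have "\<phi> (?r (arc G c)) = \<phi> (?r c)" if "c \<in> corners G" for c
      proof -
        have "\<phi> (arc H (?r c)) = \<phi> (?r c)"
          using \<phi>(1) that rK unfolding invariant_colourings_def K by blast
        then show ?thesis by (simp add: arcH r)
      qed
      then have "\<phi> \<circ> ?r \<in> invariant_colourings (corners G) (arc G) k"
        using \<phi>(1) rK unfolding mem_invariant_colourings K o_apply by metis
      moreover have "(\<lambda>p. (\<phi> \<circ> ?r) (e, p)) \<circ> \<rho> e = (\<lambda>p. \<phi> (e, p))" for e
        by (simp add: fun_eq_iff rp \<rho>)
      ultimately show "\<phi> \<circ> ?r \<in> ?Y" using \<phi>(2) by simp
    qed
    show "(\<lambda>\<phi>. \<phi> \<circ> ?r) ` ?Y \<subseteq> ?X"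
    proof (rule image_subsetI)
      fix \<phi> assume "\<phi> \<in> ?Y"
      then have \<phi>: "\<phi> \<in> invariant_colourings (corners G) (arc G) k"
        "\<forall>e\<in>edges G. C e ((\<lambda>p. \<phi> (e, p)) \<circ> \<rho> e)" by auto
      have "\<phi> (?r (arc H c)) = \<phi> (?r c)" if "c \<in> corners G" for c
      proof -
        have "\<phi> (arc G (?r c)) = \<phi> (?r c)"
          using \<phi>(1) that rK unfolding invariant_colourings_def by blast
        then show ?thesis by (simp add: arcH r)
      qed
      then have "\<phi> \<circ> ?r \<in> invariant_colourings (corners H) (arc H) k"
        using \<phi>(1) rK unfolding mem_invariant_colourings K o_apply by metis
      moreover have "(\<lambda>p. (\<phi> \<circ> ?r) (e, p)) = (\<lambda>p. \<phi> (e, p)) \<circ> \<rho> e" for e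
        by (simp add: fun_eq_iff rp)
      ultimately show "\<phi> \<circ> ?r \<in> ?X" using \<phi>(2) by simp
    qed
  qed
  from bij_betw_same_card[OF this]
  show "num_colourings H C k = num_colourings G (\<lambda>e f. C e (f \<circ> \<rho> e)) k"
    by (simp add: num_colourings_def)
qed

section \<open>Colourings of vertices\<close>

text \<open>
  Vertices and components are quotients of the set of corners and of the set of vertices. Colouring a
  quotient is the same as colouring the set constantly on the fibres of the quotient map.
\<close>

lemma bij_betw_functions_factoring:
  assumes "v ` V = W"
  shows "bij_betw (\<lambda>\<psi>. \<lambda>x\<in>V. \<psi> (v x)) (W \<rightarrow>\<^sub>E B)
    {\<phi> \<in> V \<rightarrow>\<^sub>E B. \<forall>x\<in>V. \<forall>y\<in>V. v x = v y \<longrightarrow> \<phi> x = \<phi> y}" (is "bij_betw ?f ?X ?Y")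
proof (rule bij_betw_byWitness[where f' = "\<lambda>\<phi>. \<lambda>w\<in>W. \<phi> (inv_into V v w)"])
  let ?g = "\<lambda>\<phi>. \<lambda>w\<in>W. \<phi> (inv_into V v w)"
  have inv: "inv_into V v w \<in> V" "v (inv_into V v w) = w" if "w \<in> W" for w
    using that assms inv_into_into[of w v V] f_inv_into_f[of w v V] by auto
  have vW: "v x \<in> W" if "x \<in> V" for x using that assms by auto
  show "\<forall>\<psi>\<in>?X. ?g (?f \<psi>) = \<psi>"
  proof (intro ballI ext)
    fix \<psi> w assume "\<psi> \<in> ?X"
    then show "?g (?f \<psi>) w = \<psi> w"
      using inv[of w] by (cases "w \<in> W") (auto simp: PiE_def extensional_def)
  qed
  show "\<forall>\<phi>\<in>?Y. ?f (?g \<phi>) = \<phi>"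
  proof (intro ballI ext)
    fix \<phi> x assume \<phi>: "\<phi> \<in> ?Y"
    show "?f (?g \<phi>) x = \<phi> x"
    proof (cases "x \<in> V")
      case True
      then have "\<phi> (inv_into V v (v x)) = \<phi> x" using \<phi> inv[OF vW[OF True]] by blast
      then show ?thesis using True vW by simp
    next
      case False
      then show ?thesis using \<phi> by (auto simp: PiE_def extensional_def)
    qed
  qed
  show "?f ` ?X \<subseteq> ?Y" using vW by (auto simp: PiE_def Pi_def)
  show "?g ` ?Y \<subseteq> ?X"
  proof (rule image_subsetI)
    fix \<phi> assume "\<phi> \<in> ?Y"
    then have "\<phi> (inv_into V v w) \<in> B" if "w \<in> W" for w
      using PiE_mem[OF _ inv(1)[OF that]] by blast
    then show "?g \<phi> \<in> ?X" by simp
  qed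
qed

lemma rtrancl_constant:
  assumes "(x, y) \<in> R\<^sup>*" "x \<in> V" "R `` V \<subseteq> V"
    and "\<forall>x\<in>V. \<forall>y. (x, y) \<in> R \<longrightarrow> \<phi> x = \<phi> y"
  shows "y \<in> V \<and> \<phi> x = \<phi> y"
  using assms(1,2) by (induction rule: rtrancl_induct) (use assms(3,4) in auto)

lemma rtrancl_class_eq_iff:
  assumes "sym R"
  shows "R\<^sup>* `` {x} = R\<^sup>* `` {y} \<longleftrightarrow> (x, y) \<in> R\<^sup>*"
proof
  assume "R\<^sup>* `` {x} = R\<^sup>* `` {y}"
  then have "(y, x) \<in> R\<^sup>*" by blast
  then show "(x, y) \<in> R\<^sup>*" using sym_rtrancl[OF assms] by (auto dest: symD)
next
  assume xy: "(x, y) \<in> R\<^sup>*"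
  then have "(y, x) \<in> R\<^sup>*" using sym_rtrancl[OF assms] by (auto dest: symD)
  with xy show "R\<^sup>* `` {x} = R\<^sup>* `` {y}" by (auto intro: rtrancl_trans)
qed

text \<open>
  Turns constancy on classes, a statement about paths, into a condition that can be checked on
  single links.
\<close>

lemma constant_on_classes_iff:
  assumes "sym R" "R `` V \<subseteq> V"
  shows "(\<forall>x\<in>V. \<forall>y\<in>V. R\<^sup>* `` {x} = R\<^sup>* `` {y} \<longrightarrow> \<phi> x = \<phi> y) \<longleftrightarrow>
    (\<forall>x\<in>V. \<forall>y. (x, y) \<in> R \<longrightarrow> \<phi> x = \<phi> y)"
  unfolding rtrancl_class_eq_iff[OF assms(1)]
  using rtrancl_constant[OF _ _ assms(2), of _ _ \<phi>] assms(2) by blast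

lemma card_colourings_respecting:
  assumes "finite V" "sym R" "R `` V \<subseteq> V"
  shows "card {\<phi> \<in> V \<rightarrow>\<^sub>E {..<k::nat}. \<forall>x\<in>V. \<forall>y. (x, y) \<in> R \<longrightarrow> \<phi> x = \<phi> y} =
    k ^ card (V // R\<^sup>*)"
proof -
  have "(\<lambda>x. R\<^sup>* `` {x}) ` V = V // R\<^sup>*" by (auto simp: quotient_def)
  from bij_betw_same_card[OF bij_betw_functions_factoring[OF this, of "{..<k}"]]
  have "card {\<phi> \<in> V \<rightarrow>\<^sub>E {..<k}. \<forall>x\<in>V. \<forall>y. (x, y) \<in> R \<longrightarrow> \<phi> x = \<phi> y} =
      card (V // R\<^sup>* \<rightarrow>\<^sub>E {..<k})"
    unfolding constant_on_classes_iff[OF assms(2,3)] by (rule sym)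
  also have "\<dots> = k ^ card (V // R\<^sup>*)"
    using assms(1) by (subst card_funcsetE) (auto simp: quotient_def)
  finally show ?thesis .
qed

text \<open>
  Serves to split off the isolated vertices, whose colours are unconstrained.
\<close>

lemma card_PiE_Un:
  assumes "finite J" "I \<inter> J = {}" and local: "\<And>\<phi>. P (restrict \<phi> I) = P \<phi>"
  shows "card {c \<in> I \<union> J \<rightarrow>\<^sub>E {..<k::nat}. P c} =
    k ^ card J * card {c \<in> I \<rightarrow>\<^sub>E {..<k}. P c}" (is "card ?X = _ * card ?Y")
proof -
  let ?f = "\<lambda>c. (restrict c I, restrict c J)"
  let ?g = "\<lambda>(c, d). \<lambda>x\<in>I \<union> J. if x \<in> I then c x else d x"
  have P: "P \<phi> = P \<psi>" if "\<And>x. x \<in> I \<Longrightarrow> \<phi> x = \<psi> x" for \<phi> \<psi>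
    using local[of \<phi>] local[of \<psi>] restrict_ext[of I \<phi> \<psi>] that by metis
  have "bij_betw ?f ?X (?Y \<times> (J \<rightarrow>\<^sub>E {..<k}))"
  proof (rule bij_betw_byWitness[where f' = ?g])
    show "\<forall>c\<in>?X. ?g (?f c) = c" by (auto simp: fun_eq_iff PiE_def extensional_def)
    show "\<forall>x\<in>?Y \<times> (J \<rightarrow>\<^sub>E {..<k}). ?f (?g x) = x"
      using assms(2) by (auto simp: fun_eq_iff PiE_def extensional_def)
    show "?f ` ?X \<subseteq> ?Y \<times> (J \<rightarrow>\<^sub>E {..<k})" using local by (auto simp: PiE_def Pi_def)
    show "?g ` (?Y \<times> (J \<rightarrow>\<^sub>E {..<k})) \<subseteq> ?X"
    proof (rule image_subsetI)
      fix x assume x: "x \<in> ?Y \<times> (J \<rightarrow>\<^sub>E {..<k})"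
      then have "P (?g x) = P (fst x)" by (intro P) (auto split: prod.split)
      then show "?g x \<in> ?X" using x by (auto simp: PiE_def Pi_def split: if_splits)
    qed
  qed
  from bij_betw_same_card[OF this] show ?thesis
    using assms(1) by (simp add: card_cartesian_product card_funcsetE)
qed

text \<open>
  The steps that generate \<open>vertex_boundary\<close>. The second kind also links triples that are not
  corners of \<open>G\<close>, but no link leads out of the set of corners.
\<close>

definition vertex_link :: "'e ribbon \<Rightarrow> ('e corner \<times> 'e corner) set" where
  "vertex_link G = {(a, arc G a) |a. True} \<union> {((e, i, s), (e, i, \<not> s)) |e i s. True}"

lemma vertex_linkI:
  "(x, arc G x) \<in> vertex_link G" "((e, i, s), (e, i, \<not> s)) \<in> vertex_link G"
  unfolding vertex_link_def by blast+

lemma vertex_boundary_eq: "vertex_boundary G c = (vertex_link G)\<^sup>* `` {c}"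
  by (auto simp: vertex_boundary_def vertex_link_def)

lemma sym_vertex_link:
  assumes "ribbon_graph G"
  shows "sym (vertex_link G)"
proof (rule symI)
  fix x y assume "(x, y) \<in> vertex_link G"
  then consider "y = arc G x" | e i s where "x = (e, i, s)" "y = (e, i, \<not> s)"
    by (auto simp: vertex_link_def)
  then show "(y, x) \<in> vertex_link G"
  proof cases
    case 1
    then have "arc G y = x" using assms arc_corners(2) arc_outside by metis
    then show ?thesis using vertex_linkI(1)[of y G] by simp
  next
    case 2
    then show ?thesis using vertex_linkI(2)[of e i "\<not> s" G] by simp
  qed
qed

lemma vertex_link_corners:
  assumes "ribbon_graph G"
  shows "vertex_link G `` corners G \<subseteq> corners G"
  using arc_corners(1)[OF assms] by (auto simp: vertex_link_def mem_corners)

lemma respects_vertex_link_iff: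
  assumes "ribbon_graph G"
  shows "(\<forall>x\<in>corners G. \<forall>y. (x, y) \<in> vertex_link G \<longrightarrow> \<phi> x = \<phi> y) \<longleftrightarrow>
    (\<forall>c\<in>corners G. \<phi> (arc G c) = \<phi> c) \<and>
    (\<forall>e\<in>edges G. \<forall>i. \<phi> (e, i, False) = \<phi> (e, i, True))" (is "?L \<longleftrightarrow> ?R")
proof
  assume L: ?L
  have "\<phi> (arc G c) = \<phi> c" if "c \<in> corners G" for c
    using L that vertex_linkI(1)[of c G] by metis
  moreover have "\<phi> (e, i, False) = \<phi> (e, i, True)" if "e \<in> edges G" for e i
  proof -
    have "((e, i, False), (e, i, True)) \<in> vertex_link G"
      using vertex_linkI(2)[of e i False G] by simp
    then show ?thesis using L that by (meson mem_corners)
  qed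
  ultimately show ?R by blast
next
  assume R: ?R
  show ?L
  proof (intro ballI allI impI)
    fix x y assume x: "x \<in> corners G" and "(x, y) \<in> vertex_link G"
    then consider "y = arc G x" | e i s where "x = (e, i, s)" "y = (e, i, \<not> s)"
      by (auto simp: vertex_link_def)
    then show "\<phi> x = \<phi> y"
    proof cases
      case 1 then show ?thesis using R x by simp
    next
      case 2 then show ?thesis using R x by (cases s) (auto simp: mem_corners)
    qed
  qed
qed

definition corner_vertex :: "'e ribbon \<Rightarrow> 'e corner \<Rightarrow> 'e vertex" where
  "corner_vertex G c = Boundary (vertex_boundary G c)"

lemma corner_vertex_end:
  assumes "ribbon_graph G"
  shows "corner_vertex G (e, i, s) = end_vertex G e i"
proof -
  have "((e, i, s), (e, i, False)) \<in> (vertex_link G)\<^sup>*"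
    using vertex_linkI(2)[of e i True G] by (cases s) auto
  then show ?thesis
    by (simp add: corner_vertex_def end_vertex_def vertex_boundary_eq
        rtrancl_class_eq_iff[OF sym_vertex_link[OF assms]])
qed

lemma vertices_eq:
  assumes "ribbon_graph G"
  shows "vertices G = corner_vertex G ` corners G \<union> Isolated ` {..<isolated G}"
proof -
  have "{end_vertex G e i |e i. e \<in> edges G} = corner_vertex G ` corners G"
  proof (intro equalityI subsetI)
    fix x assume "x \<in> {end_vertex G e i |e i. e \<in> edges G}"
    then obtain e i where "x = corner_vertex G (e, i, False)" "e \<in> edges G"
      using corner_vertex_end[OF assms] by auto
    then show "x \<in> corner_vertex G ` corners G" by (auto simp: mem_corners)
  next
    fix x assume "x \<in> corner_vertex G ` corners G"
    then obtain e i s where "x = corner_vertex G (e, i, s)" "e \<in> edges G"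
      by (auto simp: mem_corners)
    then show "x \<in> {end_vertex G e i |e i. e \<in> edges G}"
      using corner_vertex_end[OF assms] by auto
  qed
  then show ?thesis by (simp add: vertices_def)
qed

lemma finite_vertices: "ribbon_graph G \<Longrightarrow> finite (vertices G)"
  by (simp add: vertices_eq finite_corners)

text \<open>
  A colouring of the vertices is a free choice of colours at the isolated vertices together
  with a colouring of the corners that is constant along the arcs and across every end. The relation
  \<open>p\<close> is inequality for proper colourings, and equality for colourings of the components.
\<close>

lemma card_vertex_colourings:
  assumes G: "ribbon_graph G"
  shows "card {c \<in> vertices G \<rightarrow>\<^sub>E {..<k}.
      \<forall>e\<in>edges G. p (c (end_vertex G e False)) (c (end_vertex G e True))} =
    num_colourings G (\<lambda>e f. (\<forall>i. f (i, False) = f (i, True)) \<and>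
      p (f (False, False)) (f (True, False))) k"
proof -
  let ?K = "corners G" and ?v = "corner_vertex G"
  let ?W = "?v ` ?K" and ?J = "Isolated ` {..<isolated G} :: 'a vertex set"
  define P where "P c \<longleftrightarrow>
    (\<forall>e\<in>edges G. p (c (end_vertex G e False)) (c (end_vertex G e True)))" for c
  have end_W: "end_vertex G e i \<in> ?W" if "e \<in> edges G" for e i
    using that corner_vertex_end[OF G, of e i False] by (metis imageI mem_corners)
  have disj: "?W \<inter> ?J = {}" by (auto simp: corner_vertex_def)
  have card_J: "card ?J = isolated G" by (simp add: card_image inj_on_def)
  have "card {c \<in> vertices G \<rightarrow>\<^sub>E {..<k}. P c} =
      k ^ card ?J * card {c \<in> ?W \<rightarrow>\<^sub>E {..<k}. P c}"
    unfolding vertices_eq[OF G] using disj by (intro card_PiE_Un) (simp_all add: P_def end_W)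
  then have split: "card {c \<in> vertices G \<rightarrow>\<^sub>E {..<k}. P c} =
      k ^ isolated G * card {c \<in> ?W \<rightarrow>\<^sub>E {..<k}. P c}"
    by (simp only: card_J)
  let ?Y = "{\<phi> \<in> ?K \<rightarrow>\<^sub>E {..<k}. \<forall>x\<in>?K. \<forall>y\<in>?K. ?v x = ?v y \<longrightarrow> \<phi> x = \<phi> y}"
  let ?Q = "\<lambda>\<phi>. \<forall>e\<in>edges G. p (\<phi> (e, False, False)) (\<phi> (e, True, False))"
  have bij: "bij_betw (\<lambda>\<psi>. \<lambda>x\<in>?K. \<psi> (?v x)) (?W \<rightarrow>\<^sub>E {..<k}) ?Y"
    by (rule bij_betw_functions_factoring) simp
  have "bij_betw (\<lambda>\<psi>. \<lambda>x\<in>?K. \<psi> (?v x)) {\<psi> \<in> ?W \<rightarrow>\<^sub>E {..<k}. P \<psi>} {\<phi> \<in> ?Y. ?Q \<phi>}"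
    using bij by (rule bij_betw_Collect) (auto simp: P_def mem_corners corner_vertex_end[OF G])
  then have "card {c \<in> ?W \<rightarrow>\<^sub>E {..<k}. P c} = card {\<phi> \<in> ?Y. ?Q \<phi>}"
    by (rule bij_betw_same_card)
  also have "{\<phi> \<in> ?Y. ?Q \<phi>} = {\<phi> \<in> invariant_colourings ?K (arc G) k. \<forall>e\<in>edges G.
      (\<forall>i. \<phi> (e, i, False) = \<phi> (e, i, True)) \<and> p (\<phi> (e, False, False)) (\<phi> (e, True, False))}"
  proof -
    have "(\<forall>x\<in>?K. \<forall>y\<in>?K. ?v x = ?v y \<longrightarrow> \<phi> x = \<phi> y) \<longleftrightarrow>
        (\<forall>c\<in>?K. \<phi> (arc G c) = \<phi> c) \<and>
        (\<forall>e\<in>edges G. \<forall>i. \<phi> (e, i, False) = \<phi> (e, i, True))" for \<phi> :: "'a corner \<Rightarrow> nat"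
      unfolding respects_vertex_link_iff[OF G, symmetric]
        constant_on_classes_iff[OF sym_vertex_link[OF G] vertex_link_corners[OF G], symmetric]
      by (simp add: corner_vertex_def vertex_boundary_eq)
    then show ?thesis by (auto simp: invariant_colourings_def)
  qed
  finally show ?thesis using split by (simp add: P_def num_colourings_def)
qed

lemma card_proper_colourings:
  assumes "ribbon_graph G"
  shows "card (proper_colourings G k) =
    num_colourings G (\<lambda>e f. (\<forall>i. f (i, False) = f (i, True)) \<and>
      f (False, False) \<noteq> f (True, False)) k"
  unfolding proper_colourings_def by (rule card_vertex_colourings[OF assms])

lemma power_num_components:
  assumes G: "ribbon_graph G"
  shows "k ^ num_components G = num_colourings G (\<lambda>e f. \<forall>p q. f p = f q) k"
proof -
  let ?R = "{(end_vertex G e i, end_vertex G e j) |e i j. e \<in> edges G}"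
  have end_V: "end_vertex G e i \<in> vertices G" if "e \<in> edges G" for e i
    using that by (auto simp: vertices_def)
  have R: "sym ?R" "?R `` vertices G \<subseteq> vertices G" using end_V by (auto intro!: symI)
  have iff: "(\<forall>x\<in>vertices G. \<forall>y. (x, y) \<in> ?R \<longrightarrow> c x = c y) \<longleftrightarrow>
      (\<forall>e\<in>edges G. c (end_vertex G e False) = c (end_vertex G e True))" (is "?A \<longleftrightarrow> ?B")
    for c :: "'a vertex \<Rightarrow> nat"
  proof
    show "?A \<Longrightarrow> ?B" using end_V by blast
    assume B: ?B
    have "c (end_vertex G e i) = c (end_vertex G e j)" if "e \<in> edges G" for e i j
      using B that by (cases i; cases j) auto
    then show ?A by auto
  qed
  have "k ^ num_components G = card {c \<in> vertices G \<rightarrow>\<^sub>E {..<k}.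
      \<forall>x\<in>vertices G. \<forall>y. (x, y) \<in> ?R \<longrightarrow> c x = c y}"
    unfolding num_components_def connected_vertices_def
    using card_colourings_respecting[OF finite_vertices[OF G] R, of k] by simp
  also have "\<dots> = num_colourings G (\<lambda>e f. (\<forall>i. f (i, False) = f (i, True)) \<and>
      f (False, False) = f (True, False)) k"
    unfolding iff by (rule card_vertex_colourings[OF G])
  also have "\<dots> = num_colourings G (\<lambda>e f. \<forall>p q. f p = f q) k"
    by (intro num_colourings_cong) (auto simp: all_bool_eq)
  finally show ?thesis .
qed

section \<open>States and their regions\<close>

text \<open>
  A state chooses one of the four operations at every edge. The relation \<open>joined\<close> says which corners of
  an edge, given by end and side, come to lie on one vertex, or in one component, of the
  result.
\<close>

datatype smoothing = To_point | Contract | Delete | Penrose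

lemma UNIV_smoothing: "UNIV = {To_point, Contract, Delete, Penrose}"
  using smoothing.exhaust by auto

instance smoothing :: finite
  by standard (simp add: UNIV_smoothing)

fun joined :: "smoothing \<Rightarrow> bool \<times> bool \<Rightarrow> bool \<times> bool \<Rightarrow> bool" where
  "joined To_point (i, s) (j, t) = True"
| "joined Contract (i, s) (j, t) = (s = t)"
| "joined Delete (i, s) (j, t) = (i = j)"
| "joined Penrose (i, s) (j, t) = ((i = j) = (s = t))"

definition compatible :: "smoothing \<Rightarrow> (bool \<times> bool \<Rightarrow> nat) \<Rightarrow> bool" where
  "compatible v f \<longleftrightarrow> (\<forall>p q. joined v p q \<longrightarrow> f p = f q)"

text \<open>
  Each condition as an acyclic set of equations, a form in which it can be used for rewriting.
\<close>

lemma compatible_simps: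
  "compatible To_point f \<longleftrightarrow> f (False, False) = f (True, False) \<and>
     f (False, True) = f (True, True) \<and> f (False, False) = f (False, True)"
  "compatible Contract f \<longleftrightarrow> f (False, False) = f (True, False) \<and> f (False, True) = f (True, True)"
  "compatible Delete f \<longleftrightarrow> f (False, False) = f (False, True) \<and> f (True, False) = f (True, True)"
  "compatible Penrose f \<longleftrightarrow> f (False, False) = f (True, True) \<and> f (False, True) = f (True, False)"
  unfolding compatible_def by (simp_all add: all_bool_eq) metis+

definition state_link :: "'e ribbon \<Rightarrow> ('e \<Rightarrow> smoothing) \<Rightarrow> ('e corner \<times> 'e corner) set" where
  "state_link G S = {(c, arc G c) |c. c \<in> corners G} \<union>
     {((e, p), (e, q)) |e p q. e \<in> edges G \<and> joined (S e) p q}"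

text \<open>
  The number of connected components that remain when the operations chosen by the state are
  carried out.
\<close>

definition regions :: "'e ribbon \<Rightarrow> ('e \<Rightarrow> smoothing) \<Rightarrow> nat" where
  "regions G S = card (corners G // (state_link G S)\<^sup>*) + isolated G"

lemma joined_sym: "joined v p q \<Longrightarrow> joined v q p"
  by (cases v; cases p; cases q) auto

lemma power_regions:
  assumes G: "ribbon_graph G"
  shows "k ^ regions G S = num_colourings G (\<lambda>e. compatible (S e)) k"
proof -
  let ?R = "state_link G S"
  have "sym ?R"
  proof (rule symI)
    fix x y assume "(x, y) \<in> ?R"
    then consider "x \<in> corners G" "y = arc G x"
      | e p q where "x = (e, p)" "y = (e, q)" "e \<in> edges G" "joined (S e) p q"
      unfolding state_link_def by blast
    then show "(y, x) \<in> ?R"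
    proof cases
      case 1
      then have "y \<in> corners G" "arc G y = x" using arc_corners[OF G] by auto
      then show ?thesis unfolding state_link_def by blast
    next
      case 2
      then show ?thesis unfolding state_link_def using joined_sym by blast
    qed
  qed
  moreover have "?R `` corners G \<subseteq> corners G"
    using arc_corners(1)[OF G] unfolding state_link_def by (auto simp: mem_corners)
  ultimately have "card {\<phi> \<in> corners G \<rightarrow>\<^sub>E {..<k}.
      \<forall>x\<in>corners G. \<forall>y. (x, y) \<in> ?R \<longrightarrow> \<phi> x = \<phi> y} = k ^ card (corners G // ?R\<^sup>*)"
    by (rule card_colourings_respecting[OF finite_corners[OF G]])
  moreover have "(\<forall>x\<in>corners G. \<forall>y. (x, y) \<in> ?R \<longrightarrow> \<phi> x = \<phi> y) \<longleftrightarrow>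
      (\<forall>c\<in>corners G. \<phi> (arc G c) = \<phi> c) \<and> (\<forall>e\<in>edges G. compatible (S e) (\<lambda>p. \<phi> (e, p)))"
    (is "?A \<longleftrightarrow> ?B") for \<phi> :: "'a corner \<Rightarrow> nat"
  proof
    assume A: ?A
    have "\<phi> (arc G c) = \<phi> c" if "c \<in> corners G" for c
    proof -
      have "(c, arc G c) \<in> ?R" using that unfolding state_link_def by blast
      then show ?thesis using A that by metis
    qed
    moreover have "\<phi> (e, p) = \<phi> (e, q)" if "e \<in> edges G" "joined (S e) p q" for e p q
    proof -
      have "((e, p), (e, q)) \<in> ?R" using that unfolding state_link_def by blast
      then show ?thesis using A that mem_corners by metis
    qed
    ultimately show ?B by (auto simp: compatible_def)
  next
    assume B: ?B
    show ?A
    proof (intro ballI allI impI)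
      fix x y assume "(x, y) \<in> ?R"
      then consider "x \<in> corners G" "y = arc G x"
        | e p q where "x = (e, p)" "y = (e, q)" "e \<in> edges G" "joined (S e) p q"
        unfolding state_link_def by blast
      then show "\<phi> x = \<phi> y"
      proof cases
        case 1 then show ?thesis using B by metis
      next
        case 2 then show ?thesis using B unfolding compatible_def by metis
      qed
    qed
  qed
  ultimately show ?thesis
    by (simp add: regions_def num_colourings_def invariant_colourings_def power_add)
qed

text \<open>
  Counting colourings with two colours determines the number of regions. Hence the effect of an
  operation on regions follows from its effect on colourings, and classes need not be followed
  through the operation.
\<close>

lemma regions_eqI:
  assumes "ribbon_graph G" "ribbon_graph H"
    and "num_colourings G (\<lambda>e. compatible (S e)) 2 = num_colourings H (\<lambda>e. compatible (T e)) 2"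
  shows "regions G S = regions H T"
proof -
  have "(2::nat) ^ regions G S = 2 ^ regions H T"
    using assms power_regions[of G 2 S] power_regions[of H 2 T] by simp
  then show ?thesis by simp
qed

section \<open>The effect of the operations on an edge\<close>

lemma delete_edge_eq:
  "delete_edge e G = remove_edge e (False, False) (False, True) (True, False) (True, True) G"
  by (simp add: delete_edge_def remove_edge_def)

lemma contract_edge_eq:
  "contract_edge e G = remove_edge e (False, False) (True, False) (False, True) (True, True) G"
  by (simp add: contract_edge_def remove_edge_def)

lemma
  assumes "ribbon_graph G" "e \<in> edges G"
  shows ribbon_graph_delete_edge: "ribbon_graph (delete_edge e G)"
    and num_colourings_delete_edge:
      "num_colourings (delete_edge e G) C k = num_colourings G (C(e := compatible Delete)) k"
    and ribbon_graph_contract_edge: "ribbon_graph (contract_edge e G)"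
    and num_colourings_contract_edge:
      "num_colourings (contract_edge e G) C k = num_colourings G (C(e := compatible Contract)) k"
proof -
  have Delete: "compatible Delete =
      (\<lambda>f. f (False, False) = f (False, True) \<and> f (True, False) = f (True, True))"
    and Contract: "compatible Contract =
      (\<lambda>f. f (False, False) = f (True, False) \<and> f (False, True) = f (True, True))"
    by (auto simp: fun_eq_iff compatible_simps all_bool_eq)
  show "ribbon_graph (delete_edge e G)" "ribbon_graph (contract_edge e G)"
    unfolding delete_edge_eq contract_edge_eq
    by (rule ribbon_graph_remove_edge[OF assms]; auto)+
  show "num_colourings (delete_edge e G) C k = num_colourings G (C(e := compatible Delete)) k"
    unfolding delete_edge_eq Delete
    by (rule num_colourings_remove_edge[OF assms]; auto)
  show "num_colourings (contract_edge e G) C k = num_colourings G (C(e := compatible Contract)) k"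
    unfolding contract_edge_eq Contract
    by (rule num_colourings_remove_edge[OF assms]; auto)
qed

definition twist :: "'e set \<Rightarrow> 'e \<Rightarrow> bool \<times> bool \<Rightarrow> bool \<times> bool" where
  "twist A e = (\<lambda>(i, s). (i, if e \<in> A \<and> i then \<not> s else s))"

lemma
  assumes "ribbon_graph G"
  shows ribbon_graph_partial_petrial: "ribbon_graph (partial_petrial A G)"
    and num_colourings_partial_petrial: "num_colourings (partial_petrial A G) C k =
      num_colourings G (\<lambda>e f. C e (f \<circ> twist A e)) k"
proof -
  have eq: "partial_petrial A G =
      G\<lparr>arc := relabel_corners (twist A) \<circ> arc G \<circ> relabel_corners (twist A)\<rparr>"
  proof -
    have "reverse_end A = relabel_corners (twist A)"
      by (auto simp: fun_eq_iff reverse_end_def relabel_corners_def twist_def)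
    then show ?thesis by (simp add: partial_petrial_def)
  qed
  have inv: "twist A e (twist A e p) = p" for e p by (cases p) (auto simp: twist_def)
  show "ribbon_graph (partial_petrial A G)"
    by (rule ribbon_graph_relabel[OF assms inv eq])
  show "num_colourings (partial_petrial A G) C k =
      num_colourings G (\<lambda>e f. C e (f \<circ> twist A e)) k"
    by (rule num_colourings_relabel[OF assms inv eq])
qed

lemma
  assumes "ribbon_graph G"
  shows ribbon_graph_geometric_dual: "ribbon_graph (geometric_dual G)"
    and num_colourings_geometric_dual: "num_colourings (geometric_dual G) C k =
      num_colourings G (\<lambda>e f. C e (f \<circ> prod.swap)) k"
proof -
  have eq: "geometric_dual G =
      G\<lparr>arc := relabel_corners (\<lambda>_. prod.swap) \<circ> arc G \<circ> relabel_corners (\<lambda>_. prod.swap)\<rparr>"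
  proof -
    have "(exchange_ends_sides :: 'a corner \<Rightarrow> _) = relabel_corners (\<lambda>_. prod.swap)"
      by (auto simp: fun_eq_iff exchange_ends_sides_def relabel_corners_def)
    then show ?thesis by (simp add: geometric_dual_def)
  qed
  have inv: "prod.swap (prod.swap p) = p" for p :: "bool \<times> bool" by simp
  show "ribbon_graph (geometric_dual G)"
    by (rule ribbon_graph_relabel[OF assms inv eq])
  show "num_colourings (geometric_dual G) C k = num_colourings G (\<lambda>e f. C e (f \<circ> prod.swap)) k"
    by (rule num_colourings_relabel[OF assms inv eq])
qed

lemma edges_partial_petrial [simp]: "edges (partial_petrial A G) = edges G"
  by (simp add: partial_petrial_def)

lemma edges_geometric_dual [simp]: "edges (geometric_dual G) = edges G"
  by (simp add: geometric_dual_def)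

lemma edges_delete_edge [simp]: "edges (delete_edge e G) = edges G - {e}"
  by (simp add: delete_edge_eq)

lemma edges_contract_edge [simp]: "edges (contract_edge e G) = edges G - {e}"
  by (simp add: contract_edge_eq)

lemma edges_penrose_contract [simp]: "edges (penrose_contract e G) = edges G - {e}"
  by (simp add: penrose_contract_def)

text \<open>
  The half-twist exchanges the two sides at the end \<open>True\<close>, which turns the condition of contraction
  into the one of Penrose-contraction.
\<close>

lemma
  assumes G: "ribbon_graph G" and e: "e \<in> edges G"
  shows ribbon_graph_penrose_contract: "ribbon_graph (penrose_contract e G)"
    and num_colourings_penrose_contract:
      "num_colourings (penrose_contract e G) C k = num_colourings G (C(e := compatible Penrose)) k"
proof -
  note P = ribbon_graph_partial_petrial[OF G, of "{e}"]
  show "ribbon_graph (penrose_contract e G)"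
    unfolding penrose_contract_def using P e by (intro ribbon_graph_contract_edge) auto
  have "num_colourings (penrose_contract e G) C k =
      num_colourings (partial_petrial {e} G) (C(e := compatible Contract)) k"
    unfolding penrose_contract_def using P e by (intro num_colourings_contract_edge) auto
  also have "\<dots> = num_colourings G (\<lambda>d f. (C(e := compatible Contract)) d (f \<circ> twist {e} d)) k"
    by (rule num_colourings_partial_petrial[OF G])
  also have "\<dots> = num_colourings G (C(e := compatible Penrose)) k"
  proof (rule num_colourings_cong)
    fix d and f :: "bool \<times> bool \<Rightarrow> nat"
    have "f \<circ> twist {e} d = f" if "d \<noteq> e" using that by (auto simp: fun_eq_iff twist_def)
    then show "(C(e := compatible Contract)) d (f \<circ> twist {e} d) = (C(e := compatible Penrose)) d f"
      by (auto simp: compatible_simps twist_def)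
  qed
  finally show "num_colourings (penrose_contract e G) C k =
      num_colourings G (C(e := compatible Penrose)) k" .
qed

text \<open>
  The states of the ribbon graph without \<open>e\<close> have as many regions as the states of \<open>G\<close> that choose the
  operation at \<open>e\<close>. This is why the recursion of \<open>\<Omega>\<close> may be applied to the edges in any
  order.
\<close>

lemma
  assumes G: "ribbon_graph G" and e: "e \<in> edges G"
  shows regions_delete_edge: "regions (delete_edge e G) S = regions G (S(e := Delete))"
    and regions_contract_edge: "regions (contract_edge e G) S = regions G (S(e := Contract))"
    and regions_penrose_contract: "regions (penrose_contract e G) S = regions G (S(e := Penrose))"
proof -
  have upd: "(\<lambda>d. compatible ((S(e := v)) d)) = (\<lambda>d. compatible (S d))(e := compatible v)" for v
    by auto
  show "regions (delete_edge e G) S = regions G (S(e := Delete))"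
    by (rule regions_eqI[OF ribbon_graph_delete_edge[OF G e] G])
      (simp only: upd num_colourings_delete_edge[OF G e])
  show "regions (contract_edge e G) S = regions G (S(e := Contract))"
    by (rule regions_eqI[OF ribbon_graph_contract_edge[OF G e] G])
      (simp only: upd num_colourings_contract_edge[OF G e])
  show "regions (penrose_contract e G) S = regions G (S(e := Penrose))"
    by (rule regions_eqI[OF ribbon_graph_penrose_contract[OF G e] G])
      (simp only: upd num_colourings_penrose_contract[OF G e])
qed

text \<open>
  For the edgeless edge-point ribbon graphs, which have a single state.
\<close>

lemma regions_all_points:
  assumes G: "ribbon_graph G" and S: "\<And>e. e \<in> edges G \<Longrightarrow> S e = To_point"
  shows "regions G S = num_components G"
proof -
  have "(2::nat) ^ regions G S = 2 ^ num_components G"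
    unfolding power_regions[OF G] power_num_components[OF G]
    by (rule num_colourings_cong) (simp only: S compatible_def joined.simps split_paired_All simp_thms)
  then show ?thesis by simp
qed

section \<open>\<open>\<Omega>\<close> as a state sum\<close>

text \<open>
  At the dark grey edges the choice has already been made: they have been contracted to points.
\<close>

definition states :: "'e edge_point \<Rightarrow> ('e \<Rightarrow> smoothing) set" where
  "states = (\<lambda>(G, D). PiE (edges G) (\<lambda>e. if e \<in> D then {To_point} else UNIV))"

fun smoothing_var :: "smoothing \<Rightarrow> omega_var" where
  "smoothing_var To_point = Var_w"
| "smoothing_var Contract = Var_x"
| "smoothing_var Delete = Var_y"
| "smoothing_var Penrose = Var_z"

definition state_sum :: "'e edge_point \<Rightarrow> omega_ring" where
  "state_sum H = (if edge_point_ribbon_graph H then \<Sum>S\<in>states H.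
     (\<Prod>e\<in>edges (fst H) - snd H. indeterminate (smoothing_var (S e))) *
       indeterminate Var_t ^ regions (fst H) S else 0)"

lemma sum_PiE_insert:
  assumes "e \<notin> E"
  shows "(\<Sum>S\<in>PiE (insert e E) T. g S) = (\<Sum>v\<in>T e. \<Sum>S\<in>PiE E T. g (S(e := v)))"
proof -
  have "(\<Sum>S\<in>PiE (insert e E) T. g S) = (\<Sum>(v, S)\<in>T e \<times> PiE E T. g (S(e := v)))"
    unfolding PiE_insert_eq
    by (subst sum.reindex[OF inj_combinator[OF assms]]) (simp add: case_prod_unfold)
  then show ?thesis by (simp add: sum.cartesian_product)
qed

text \<open>
  Sorting the states by their value at \<open>e\<close> splits the state sum into four parts, which are the state
  sums after the four operations on \<open>e\<close>.
\<close>

lemma satisfies_omega_recursion_state_sum: "satisfies_omega_recursion state_sum"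
  unfolding satisfies_omega_recursion_def
proof (intro conjI allI impI)
  fix H :: "'a edge_point" assume "\<not> edge_point_ribbon_graph H"
  then show "state_sum H = 0" by (simp add: state_sum_def)
next
  fix G :: "'a ribbon" and D e
  assume "edge_point_ribbon_graph (G, D) \<and> e \<in> edges G - D"
  then have G: "ribbon_graph G" and D: "D \<subseteq> edges G" and e: "e \<in> edges G" "e \<notin> D"
    by (auto simp: edge_point_ribbon_graph_def)
  define E where "E = edges G - {e}"
  define T where "T d = (if d \<in> D then {To_point} else UNIV)" for d
  define W where "W S = (\<Prod>d\<in>E - D. indeterminate (smoothing_var (S d)))" for S :: "'a \<Rightarrow> smoothing"
  \<comment> \<open>The part of the state sum from the states with value \<open>v\<close> at \<open>e\<close>, without the weight of \<open>e\<close>.\<close>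
  define c where "c v = (\<Sum>S\<in>PiE E T. W S * indeterminate Var_t ^ regions G (S(e := v)))" for v
  have E: "edges G = insert e E" "e \<notin> E" "finite E"
    using e G by (auto simp: E_def ribbon_graph_def)
  have Gd: "edges G - D = insert e (E - D)" using E e by auto
  have W: "W (S(e := v)) = W S" for S v
    unfolding W_def using E(2) by (intro prod.cong) auto
  have "state_sum (G, D) = (\<Sum>S\<in>PiE (insert e E) T.
      indeterminate (smoothing_var (S e)) * W S * indeterminate Var_t ^ regions G S)"
  proof -
    have "states (G, D) = PiE (insert e E) T"
      unfolding states_def T_def E(1)[symmetric] by simp
    moreover have "(\<Prod>d\<in>edges G - D. indeterminate (smoothing_var (S d))) =
        indeterminate (smoothing_var (S e)) * W S" for S
      unfolding Gd W_def using E by simp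
    ultimately show ?thesis
      using G D by (simp add: state_sum_def edge_point_ribbon_graph_def)
  qed
  also have "\<dots> = (\<Sum>v\<in>UNIV. indeterminate (smoothing_var v) * c v)"
    using e by (simp add: sum_PiE_insert[OF E(2)] W c_def sum_distrib_left mult.assoc T_def)
  also have "\<dots> = indeterminate Var_w * c To_point + indeterminate Var_x * c Contract +
      indeterminate Var_y * c Delete + indeterminate Var_z * c Penrose"
    by (simp add: UNIV_smoothing)
  finally have "state_sum (G, D) = \<dots>" .
  moreover have "state_sum (G, insert e D) = c To_point"
  proof -
    have "PiE E (\<lambda>d. if d \<in> insert e D then {To_point} else UNIV) = PiE E T"
      using E(2) by (intro PiE_cong) (auto simp: T_def)
    moreover have "edges G - insert e D = E - D" using E by auto
    ultimately show ?thesis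
      using G D e(1)
      by (simp add: state_sum_def states_def edge_point_ribbon_graph_def E(1)
          sum_PiE_insert[OF E(2)] W[unfolded W_def fun_upd_apply] c_def W_def)
  qed
  moreover have "state_sum (H, D) = c v"
    if "ribbon_graph H" "edges H = E" "\<And>S. regions H S = regions G (S(e := v))" for H v
  proof -
    have "states (H, D) = PiE E T" by (simp add: states_def T_def[abs_def] that(2))
    moreover have "D \<subseteq> E" using D e by (auto simp: E_def)
    ultimately show ?thesis
      using that by (simp add: state_sum_def edge_point_ribbon_graph_def c_def W_def)
  qed
  note this[OF ribbon_graph_contract_edge[OF G e(1)] _ regions_contract_edge[OF G e(1)]]
    this[OF ribbon_graph_delete_edge[OF G e(1)] _ regions_delete_edge[OF G e(1)]]
    this[OF ribbon_graph_penrose_contract[OF G e(1)] _ regions_penrose_contract[OF G e(1)]]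
  ultimately show "state_sum (G, D) =
      indeterminate Var_w * state_sum (G, insert e D) +
      indeterminate Var_x * state_sum (contract_edge e G, D) +
      indeterminate Var_y * state_sum (delete_edge e G, D) +
      indeterminate Var_z * state_sum (penrose_contract e G, D)"
    by (simp add: E_def)
next
  fix G :: "'a ribbon" and D
  assume "edge_point_ribbon_graph (G, D) \<and> edges G - D = {}"
  then have G: "edge_point_ribbon_graph (G, D)" "ribbon_graph G" and D: "edges G = D"
    by (auto simp: edge_point_ribbon_graph_def)
  have "states (G, D) = {restrict (\<lambda>_. To_point) D}"
    by (auto simp: states_def D PiE_def extensional_def fun_eq_iff Pi_def)
  then show "state_sum (G, D) = indeterminate Var_t ^ num_components G"
    using G D regions_all_points[OF G(2), of "restrict (\<lambda>_. To_point) D"]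
    by (simp add: state_sum_def)
qed

lemma satisfies_omega_recursionD:
  assumes "satisfies_omega_recursion f"
  shows "\<not> edge_point_ribbon_graph H \<Longrightarrow> f H = 0"
    and "edge_point_ribbon_graph (G, D) \<Longrightarrow> e \<in> edges G - D \<Longrightarrow> f (G, D) =
      indeterminate Var_w * f (G, insert e D) + indeterminate Var_x * f (contract_edge e G, D) +
      indeterminate Var_y * f (delete_edge e G, D) +
      indeterminate Var_z * f (penrose_contract e G, D)"
    and "edge_point_ribbon_graph (G, D) \<Longrightarrow> edges G - D = {} \<Longrightarrow>
      f (G, D) = indeterminate Var_t ^ num_components G"
  using assms unfolding satisfies_omega_recursion_def by blast+

text \<open>
  Every term on the right of the recursion has one light grey edge less.
\<close>

lemma satisfies_omega_recursion_unique:
  assumes f: "satisfies_omega_recursion f" and g: "satisfies_omega_recursion g"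
  shows "f = g"
proof
  fix H :: "'a edge_point"
  show "f H = g H"
  proof (induction "card (edges (fst H) - snd H)" arbitrary: H rule: less_induct)
    case less
    obtain G D where H: "H = (G, D)" by (cases H)
    show ?case
    proof (cases "edge_point_ribbon_graph H")
      case False
      then show ?thesis
        by (metis satisfies_omega_recursionD(1)[OF f] satisfies_omega_recursionD(1)[OF g])
    next
      case True
      then have G: "ribbon_graph G" and D: "D \<subseteq> edges G"
        by (auto simp: H edge_point_ribbon_graph_def)
      show ?thesis
      proof (cases "edges G - D = {}")
        case True': True
        with True show ?thesis
          unfolding H by (simp only: satisfies_omega_recursionD(3)[OF f] satisfies_omega_recursionD(3)[OF g])
      next
        case False
        then obtain e where e: "e \<in> edges G - D" by blast
        have fin: "finite (edges G - D)" using G by (simp add: ribbon_graph_def)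
        have card: "card (edges G - D - {e}) < card (edges G - D)"
          by (rule card_Diff1_less[OF fin e])
        have sets: "edges G - insert e D = edges G - D - {e}"
          "edges G - {e} - D = edges G - D - {e}" by auto
        have "f (G, insert e D) = g (G, insert e D)"
          "f (contract_edge e G, D) = g (contract_edge e G, D)"
          "f (delete_edge e G, D) = g (delete_edge e G, D)"
          "f (penrose_contract e G, D) = g (penrose_contract e G, D)"
          by (rule less; use card in \<open>simp add: H sets\<close>)+
        then show ?thesis
          using True
          unfolding H by (simp only: satisfies_omega_recursionD(2)[OF f _ e]
              satisfies_omega_recursionD(2)[OF g _ e])
      qed
    qed
  qed
qed

lemma Omega_eq_state_sum: "Omega = state_sum"
  unfolding Omega_def
  using satisfies_omega_recursion_state_sum satisfies_omega_recursion_unique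
  by (intro the_equality) auto

section \<open>Evaluating elements of \<open>omega_ring\<close>\<close>

text \<open>
  Over a common finite set of monomials evaluation is visibly additive.
\<close>

lemma eval_omega_ring_superset:
  assumes "finite M" "Poly_Mapping.keys p \<subseteq> M"
  shows "eval_omega_ring p w x y z t = (\<Sum>m\<in>M. of_int (Poly_Mapping.lookup p m) *
        w ^ Poly_Mapping.lookup m Var_w * x ^ Poly_Mapping.lookup m Var_x *
        y ^ Poly_Mapping.lookup m Var_y * z ^ Poly_Mapping.lookup m Var_z *
        t ^ Poly_Mapping.lookup m Var_t)"
  unfolding eval_omega_ring_def
  by (rule sum.mono_neutral_left) (use assms in \<open>auto simp: in_keys_iff\<close>)

lemma eval_omega_ring_0 [simp]: "eval_omega_ring 0 w x y z t = 0"
  by (simp add: eval_omega_ring_def)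

lemma eval_omega_ring_1 [simp]: "eval_omega_ring 1 w x y z t = 1"
proof -
  have "(1 :: omega_ring) = Poly_Mapping.single 0 1" by simp
  then show ?thesis by (simp only: eval_omega_ring_def) (simp add: lookup_single)
qed

lemma eval_omega_ring_add [simp]:
  "eval_omega_ring (p + q) w x y z t = eval_omega_ring p w x y z t + eval_omega_ring q w x y z t"
proof -
  let ?M = "Poly_Mapping.keys p \<union> Poly_Mapping.keys q"
  have "finite ?M" "Poly_Mapping.keys (p + q) \<subseteq> ?M" by (simp_all add: keys_add)
  then show ?thesis
    by (simp add: eval_omega_ring_superset[of ?M] lookup_add algebra_simps sum.distrib)
qed

lemma eval_omega_ring_sum:
  "eval_omega_ring (\<Sum>i\<in>I. p i) w x y z t = (\<Sum>i\<in>I. eval_omega_ring (p i) w x y z t)"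
  by (induction I rule: infinite_finite_induct) auto

fun variable_value :: "'r \<Rightarrow> 'r \<Rightarrow> 'r \<Rightarrow> 'r \<Rightarrow> 'r \<Rightarrow> omega_var \<Rightarrow> 'r" where
  "variable_value w x y z t Var_w = w"
| "variable_value w x y z t Var_x = x"
| "variable_value w x y z t Var_y = y"
| "variable_value w x y z t Var_z = z"
| "variable_value w x y z t Var_t = t"

text \<open>
  Products of indeterminates are the only products in the state sum, so multiplicativity is needed for
  an indeterminate factor only; there it follows from the case of a single monomial by additivity.
\<close>

lemma eval_omega_ring_indeterminate_mult [simp]:
  "eval_omega_ring (indeterminate v * p) w x y z t =
     variable_value w x y z t v * eval_omega_ring p w x y z t"
proof (induction p rule: update_induct)
  case (update p m a)
  have eq: "Poly_Mapping.update m a p = Poly_Mapping.single m a + p"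
    using update(1) by (intro poly_mapping_eqI)
      (auto simp: lookup_update lookup_add lookup_single in_keys_iff)
  have "eval_omega_ring (indeterminate v * Poly_Mapping.single m a) w x y z t =
      variable_value w x y z t v * eval_omega_ring (Poly_Mapping.single m a) w x y z t"
    by (cases v) (simp_all add: indeterminate_def mult_single eval_omega_ring_def lookup_add
        lookup_single algebra_simps)
  then show ?case unfolding eq by (simp add: distrib_left update)
qed simp

lemma eval_omega_ring_prod_mult:
  "eval_omega_ring ((\<Prod>i\<in>I. indeterminate (v i)) * p) w x y z t =
     (\<Prod>i\<in>I. variable_value w x y z t (v i)) * eval_omega_ring p w x y z t"
  by (induction I rule: infinite_finite_induct) (auto simp: mult.assoc)

lemma eval_omega_ring_power:
  "eval_omega_ring (indeterminate v ^ n) w x y z t = variable_value w x y z t v ^ n"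
  by (induction n) auto

section \<open>State sums with integer weights\<close>

text \<open>
  Both the evaluation of \<open>\<Omega>\<close> in question and the chromatic polynomial have this form.
\<close>

definition weighted_state_sum :: "'e ribbon \<Rightarrow> (smoothing \<Rightarrow> int) \<Rightarrow> int poly" where
  "weighted_state_sum G a =
     (\<Sum>S\<in>edges G \<rightarrow>\<^sub>E UNIV. (\<Prod>e\<in>edges G. [:a (S e):]) * [:0, 1:] ^ regions G S)"

lemma eval_omega_ring_Omega:
  assumes "ribbon_graph G"
  shows "eval_omega_ring (Omega (G, {})) [:a To_point:] [:a Contract:] [:a Delete:] [:a Penrose:]
    [:0, 1:] = weighted_state_sum G a"
proof -
  have "variable_value [:a To_point:] [:a Contract:] [:a Delete:] [:a Penrose:] [:0, 1:]
      (smoothing_var v) = [:a v:]" for v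
    by (cases v) auto
  then show ?thesis
    using assms by (simp add: Omega_eq_state_sum state_sum_def states_def
        edge_point_ribbon_graph_def eval_omega_ring_sum eval_omega_ring_prod_mult
        eval_omega_ring_power weighted_state_sum_def)
qed

lemma sum_smoothing:
  "(\<Sum>v\<in>UNIV. h v) = h To_point + h Contract + h Delete + (h Penrose :: 'a::comm_monoid_add)"
  by (simp add: UNIV_smoothing add.assoc)

lemma of_bool_Ball: "finite E \<Longrightarrow> of_bool (\<forall>e\<in>E. Q e) = (\<Prod>e\<in>E. of_bool (Q e) :: int)"
  by (induction E rule: finite_induct) auto

lemma num_colourings_eq_sum:
  assumes G: "ribbon_graph G"
  shows "int (num_colourings G C k) = int k ^ isolated G *
    (\<Sum>\<phi>\<in>invariant_colourings (corners G) (arc G) k. \<Prod>e\<in>edges G. of_bool (C e (\<lambda>p. \<phi> (e, p))))"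
proof -
  let ?I = "invariant_colourings (corners G) (arc G) k"
  have E: "finite (edges G)" using G by (simp add: ribbon_graph_def)
  have "int (card {\<phi> \<in> ?I. \<forall>e\<in>edges G. C e (\<lambda>p. \<phi> (e, p))}) =
      (\<Sum>\<phi>\<in>?I. of_bool (\<forall>e\<in>edges G. C e (\<lambda>p. \<phi> (e, p))))"
    using finite_invariant_colourings[OF finite_corners[OF G]] by (simp add: Int_def)
  then show ?thesis by (simp only: num_colourings_def of_bool_Ball[OF E] of_nat_mult of_nat_power)
qed

text \<open>
  At a natural number the power belonging to a state is itself a sum over colourings. Once the
  sum over colourings is pulled out, the sum over states becomes a product over the edges.
\<close>

lemma poly_weighted_state_sum:
  assumes G: "ribbon_graph G"
  shows "poly (weighted_state_sum G a) (int k) = int k ^ isolated G *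
    (\<Sum>\<phi>\<in>invariant_colourings (corners G) (arc G) k.
      \<Prod>e\<in>edges G. \<Sum>v\<in>UNIV. a v * of_bool (compatible v (\<lambda>p. \<phi> (e, p))))"
proof -
  let ?I = "invariant_colourings (corners G) (arc G) k"
  let ?c = "\<lambda>\<phi> e v. of_bool (compatible v (\<lambda>p. \<phi> (e, p))) :: int"
  have E: "finite (edges G)" using G by (simp add: ribbon_graph_def)
  have "poly (weighted_state_sum G a) (int k) =
      (\<Sum>S\<in>edges G \<rightarrow>\<^sub>E UNIV. (\<Prod>e\<in>edges G. a (S e)) * int (k ^ regions G S))"
    by (simp add: weighted_state_sum_def poly_sum poly_prod)
  also have "\<dots> = int k ^ isolated G *
      (\<Sum>S\<in>edges G \<rightarrow>\<^sub>E UNIV. \<Sum>\<phi>\<in>?I. \<Prod>e\<in>edges G. a (S e) * ?c \<phi> e (S e))"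
    unfolding power_regions[OF G] num_colourings_eq_sum[OF G]
    by (simp add: sum_distrib_left prod.distrib algebra_simps)
  also have "\<dots> = int k ^ isolated G *
      (\<Sum>\<phi>\<in>?I. \<Sum>S\<in>edges G \<rightarrow>\<^sub>E UNIV. \<Prod>e\<in>edges G. a (S e) * ?c \<phi> e (S e))"
    by (subst sum.swap) simp
  also have "\<dots> = int k ^ isolated G * (\<Sum>\<phi>\<in>?I. \<Prod>e\<in>edges G. \<Sum>v\<in>UNIV. a v * ?c \<phi> e v)"
    by (subst prod_sum_PiE[OF E]) auto
  finally show ?thesis .
qed

lemma int_poly_eqI:
  fixes p q :: "int poly"
  assumes "\<And>k::nat. poly p (int k) = poly q (int k)"
  shows "p = q"
proof (rule ccontr)
  assume "p \<noteq> q"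
  then have "finite {x. poly (p - q) x = 0}" by (intro poly_roots_finite) simp
  moreover have "range int \<subseteq> {x. poly (p - q) x = 0}" using assms by auto
  ultimately have "finite (range int)" by (rule rev_finite_subset)
  then show False using finite_imageD[of int UNIV] by (simp add: inj_on_def)
qed

text \<open>
  Some polynomial has to take the values that define \<open>chromatic_poly\<close>. A state sum does: the
  colours of the two ends of an edge differ precisely when each end has a single colour
  but not all four corners agree, which is the weight \<open>1\<close> on deletion and \<open>- 1\<close> on the
  contraction to a point.
\<close>

lemma poly_chromatic_poly:
  assumes G: "ribbon_graph G"
  shows "poly (chromatic_poly G) (int k) = int (card (proper_colourings G k))"
proof -
  define a :: "smoothing \<Rightarrow> int" where "a = (\<lambda>v. 0)(Delete := 1, To_point := - 1)"
  define p where "p = weighted_state_sum G a"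
  have edge: "(\<Sum>v\<in>UNIV. a v * of_bool (compatible v f)) =
      of_bool ((\<forall>i. f (i, False) = f (i, True)) \<and> f (False, False) \<noteq> f (True, False))" for f
    unfolding sum_smoothing by (auto simp: a_def compatible_simps all_bool_eq)
  have "poly p (int k) = int (card (proper_colourings G k))" for k
    unfolding p_def poly_weighted_state_sum[OF G] card_proper_colourings[OF G]
      num_colourings_eq_sum[OF G] edge by simp
  then have "\<exists>!p. \<forall>k. poly p (int k) = int (card (proper_colourings G k))"
    by (intro ex1I[of _ p]) (auto intro: int_poly_eqI)
  from theI'[OF this] show ?thesis unfolding chromatic_poly_def by blast
qed

section \<open>The identity\<close>

text \<open>
  The vertices of the dual of the partial Petrial are its boundary components. An edge gives
  each of its sides a single colour, and a twisted edge exchanges its sides half-way, so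
  the condition on the corners of \<open>G\<close> is the one of contraction or of Penrose-contraction. Its two
  sides have different colours if its two corners on the end \<open>False\<close>, which the twist
  leaves in place, do.
\<close>

lemma card_proper_colourings_dual_petrial:
  assumes G: "ribbon_graph G"
  shows "card (proper_colourings (geometric_dual (partial_petrial A G)) k) =
    num_colourings G (\<lambda>e f. compatible (if e \<in> A then Penrose else Contract) f \<and>
      f (False, False) \<noteq> f (False, True)) k"
  unfolding card_proper_colourings[OF ribbon_graph_geometric_dual[OF ribbon_graph_partial_petrial[OF G]]]
    num_colourings_geometric_dual[OF ribbon_graph_partial_petrial[OF G]]
    num_colourings_partial_petrial[OF G]
  by (rule num_colourings_cong) (auto simp: twist_def compatible_simps all_bool_eq)

theorem corollary4p4:
  fixes G :: "'e ribbon"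
  assumes "ribbon_graph G"
  shows "eval_omega_ring (Omega (G, {})) (-2) 1 0 1 [:0, 1:]
       = (\<Sum>A\<in>Pow (edges G). chromatic_poly (geometric_dual (partial_petrial A G)))"
proof (rule int_poly_eqI)
  fix k :: nat
  let ?I = "invariant_colourings (corners G) (arc G) k"
  let ?d = "\<lambda>v \<phi> e. of_bool (compatible v (\<lambda>p. \<phi> (e, p)) \<and>
    \<phi> (e, False, False) \<noteq> \<phi> (e, False, True)) :: int"
  have E: "finite (edges G)" using assms by (simp add: ribbon_graph_def)
  define a :: "smoothing \<Rightarrow> int" where
    "a = (\<lambda>v. 0)(To_point := - 2, Contract := 1, Penrose := 1)"
  \<comment> \<open>The weight \<open>- 2\<close> cancels the case of four equal colours, which satisfies both conditions.\<close>
  have edge: "(\<Sum>v\<in>UNIV. a v * of_bool (compatible v (\<lambda>p. \<phi> (e, p)))) =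
      ?d Penrose \<phi> e + ?d Contract \<phi> e" for \<phi> :: "'e corner \<Rightarrow> nat" and e
    unfolding sum_smoothing by (auto simp: a_def compatible_simps all_bool_eq)
  \<comment> \<open>The summand of \<open>A\<close> in the expansion of the product over the edges.\<close>
  have split: "(\<Prod>e\<in>edges G. ?d (if e \<in> A then Penrose else Contract) \<phi> e) =
      (\<Prod>e\<in>A. ?d Penrose \<phi> e) * (\<Prod>e\<in>edges G - A. ?d Contract \<phi> e)"
    if "A \<in> Pow (edges G)" for A \<phi>
  proof -
    have A: "A \<subseteq> edges G" using that by simp
    show ?thesis
      unfolding prod.subset_diff[OF A E]
      by (subst mult.commute) (intro arg_cong2[where f = "(*)"] prod.cong; auto)
  qed
  have "eval_omega_ring (Omega (G, {})) (-2) 1 0 1 [:0, 1:] = weighted_state_sum G a"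
    using eval_omega_ring_Omega[OF assms, of a] by (simp add: a_def one_pCons numeral_poly)
  then have "poly (eval_omega_ring (Omega (G, {})) (-2) 1 0 1 [:0, 1:]) (int k) =
      int k ^ isolated G * (\<Sum>\<phi>\<in>?I. \<Prod>e\<in>edges G. ?d Penrose \<phi> e + ?d Contract \<phi> e)"
    by (simp only: poly_weighted_state_sum[OF assms] edge)
  also have "\<dots> = int k ^ isolated G * (\<Sum>\<phi>\<in>?I. \<Sum>A\<in>Pow (edges G).
      \<Prod>e\<in>edges G. ?d (if e \<in> A then Penrose else Contract) \<phi> e)"
    unfolding prod_add[OF E] using split by (intro arg_cong2[where f = "(*)"] sum.cong refl) simp
  also have "\<dots> = (\<Sum>A\<in>Pow (edges G). int k ^ isolated G * (\<Sum>\<phi>\<in>?I.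
      \<Prod>e\<in>edges G. ?d (if e \<in> A then Penrose else Contract) \<phi> e))"
    by (subst sum.swap) (simp add: sum_distrib_left)
  also have "\<dots> = (\<Sum>A\<in>Pow (edges G).
      int (card (proper_colourings (geometric_dual (partial_petrial A G)) k)))"
    unfolding card_proper_colourings_dual_petrial[OF assms] num_colourings_eq_sum[OF assms] by simp
  also have "\<dots> = (\<Sum>A\<in>Pow (edges G).
      poly (chromatic_poly (geometric_dual (partial_petrial A G))) (int k))"
    using ribbon_graph_geometric_dual[OF ribbon_graph_partial_petrial[OF assms]]
    by (simp add: poly_chromatic_poly)
  finally show "poly (eval_omega_ring (Omega (G, {})) (-2) 1 0 1 [:0, 1:]) (int k) =
      poly (\<Sum>A\<in>Pow (edges G). chromatic_poly (geometric_dual (partial_petrial A G))) (int k)"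
    by (simp add: poly_sum)
qed

end
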